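(* For every $1<r<\infty$ and $1<q\le\infty$ there is a constant $C_{r,q}>0$, depending only on $r$ and $q$, such that the following holds. Let $1<r,s<\infty$, $1<q\le\infty$ and $k>0$. Then for any $k$-Hadamard operator $A:L^1(\mathbb{R})\to L^\infty(\mathbb{R})$ and any function $f:\mathbb{R}\to\mathbb{C}$ that is doubly $L^1$ for $A$, \[ M_r(f)^{\frac{q-1}{qr+q-2}}\,M_s(Af)^{\frac{q-1}{qs+q-2}}\ \ge\ C_{r,q}\,C_{s,q}\,k^{1-\frac1q}\,\|f\|_q^{\frac{2q-2}{qr+q-2}}\,\|Af\|_q^{\frac{2q-2}{qs+q-2}} . \] In particular, if $s=r$, then \[ M_r(f)\,M_r(Af)\ \ge\ C'_{r,q}\,k^{\frac{qr+q-2}{q}}\,\|f\|_q^2\,\|Af\|_q^2, \] where $C'_{r,q}=C_{r,q}^{2(qr+q-2)/(q-1)}$.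
   Context: Norms are with respect to Lebesgue measure on $\mathbb{R}$. For $1<r<\infty$ and a function $g$, $M_r(g)=\int_{\mathbb{R}}|x|^r|g(x)|^2\,dx\in[0,\infty]$. Given a linear operator $A:L^1(\mathbb{R})\to L^\infty(\mathbb{R})$, a function $f$ is called doubly $L^1$ for $A$ if $f\in L^1(\mathbb{R})$ and $Af\in L^1(\mathbb{R})$. The operator $A$ is called $k$-Hadamard if $\|A\|_{1\to\infty}\le 1$ (i.e. $\|Af\|_\infty\le\|f\|_1$ for all $f\in L^1(\mathbb{R})$) and $\|A^*Af\|_\infty\ge k\|f\|_\infty$ for all $f$ that are doubly $L^1$ for $A$. Here $A^*:L^1(\mathbb{R})\to L^\infty(\mathbb{R})$ is the adjoint, determined by $\int (Af)\,\overline{g}\,dx=\int f\,\overline{A^*g}\,dx$ for all $f,g\in L^1(\mathbb{R})$. Exponents involving $q$ are interpreted by taking limits when $q=\infty$ (e.g. $\frac{q-1}{qr+q-2}$ becomes $\frac1{r+1}$, and $\frac{qr+q-2}{q}$ becomes $r+1$). *)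

theory Defs
  imports "HOL-Probability.Essential_Supremum"
begin

text \<open>
  Elements of \<open>L\<^sup>p(\<real>)\<close> are represented by functions, and equality in \<open>L\<^sup>p\<close> by equality almost
  everywhere. All norms and moments take values in \<open>[0, \<infinity>]\<close>.
\<close>

text \<open>
  Powers of extended nonnegative numbers. Only positive exponents are meaningful here:
  \<open>0\<close> and \<open>\<infinity>\<close> are fixed.
\<close>

definition epowr :: "ennreal \<Rightarrow> real \<Rightarrow> ennreal"  (infixr "epowr" 80)
  where "x epowr a = (if x = \<infinity> then \<infinity> else ennreal (enn2real x powr a))"

definition Lp_norm :: "ennreal \<Rightarrow> (real \<Rightarrow> complex) \<Rightarrow> ennreal"
  where "Lp_norm p g =
    (if p = \<infinity> then esssup lebesgue (\<lambda>x. ennreal (cmod (g x)))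
     else (\<integral>\<^sup>+ x. ennreal (cmod (g x) powr enn2real p) \<partial>lebesgue) epowr (1 / enn2real p))"

definition moment :: "real \<Rightarrow> (real \<Rightarrow> complex) \<Rightarrow> ennreal"
  where "moment r g = (\<integral>\<^sup>+ x. ennreal (\<bar>x\<bar> powr r * (cmod (g x))\<^sup>2) \<partial>lebesgue)"

definition L1_space :: "(real \<Rightarrow> complex) set"
  where "L1_space = {g. integrable lebesgue g}"

definition Linf_space :: "(real \<Rightarrow> complex) set"
  where "Linf_space = {g \<in> borel_measurable lebesgue. Lp_norm \<infinity> g < \<infinity>}"

text \<open>
  A linear operator from \<open>L\<^sup>1(\<real>)\<close> to \<open>L\<^sup>\<infinity>(\<real>)\<close>, acting on representatives: it is well defined on
  classes modulo equality almost everywhere, and complex linear as a map of such classes.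
\<close>

definition linear_L1_Linf :: "((real \<Rightarrow> complex) \<Rightarrow> real \<Rightarrow> complex) \<Rightarrow> bool"
  where "linear_L1_Linf A \<longleftrightarrow>
    (\<forall>f\<in>L1_space. A f \<in> Linf_space) \<and>
    (\<forall>f\<in>L1_space. \<forall>g\<in>L1_space.
       (AE x in lebesgue. f x = g x) \<longrightarrow> (AE x in lebesgue. A f x = A g x)) \<and>
    (\<forall>f\<in>L1_space. \<forall>g\<in>L1_space. AE x in lebesgue. A (\<lambda>y. f y + g y) x = A f x + A g x) \<and>
    (\<forall>c. \<forall>f\<in>L1_space. AE x in lebesgue. A (\<lambda>y. c * f y) x = c * A f x)"

text \<open>
  The adjoint, given by \<open>\<integral> (A f) * cnj g = \<integral> f * cnj (adjoint_L1 A g)\<close> for all \<open>f\<close> in \<open>L\<^sup>1\<close>. The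
  function chosen is unique up to equality almost everywhere, and it exists whenever \<open>A\<close> is a
  bounded linear operator from \<open>L\<^sup>1\<close> to \<open>L\<^sup>\<infinity>\<close> and \<open>g\<close> is in \<open>L\<^sup>1\<close>, as \<open>L\<^sup>\<infinity>\<close> is the dual of \<open>L\<^sup>1\<close>.
\<close>

definition adjoint_L1 ::
    "((real \<Rightarrow> complex) \<Rightarrow> real \<Rightarrow> complex) \<Rightarrow> (real \<Rightarrow> complex) \<Rightarrow> real \<Rightarrow> complex"
  where "adjoint_L1 A g =
    (SOME h. h \<in> Linf_space \<and>
       (\<forall>f\<in>L1_space.
          (LINT x|lebesgue. A f x * cnj (g x)) = (LINT x|lebesgue. f x * cnj (h x))))"

definition doubly_L1 :: "((real \<Rightarrow> complex) \<Rightarrow> real \<Rightarrow> complex) \<Rightarrow> (real \<Rightarrow> complex) \<Rightarrow> bool"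
  where "doubly_L1 A f \<longleftrightarrow> f \<in> L1_space \<and> A f \<in> L1_space"

definition Hadamard_op :: "real \<Rightarrow> ((real \<Rightarrow> complex) \<Rightarrow> real \<Rightarrow> complex) \<Rightarrow> bool"
  where "Hadamard_op k A \<longleftrightarrow>
    linear_L1_Linf A \<and>
    (\<forall>f\<in>L1_space. Lp_norm \<infinity> (A f) \<le> Lp_norm 1 f) \<and>
    (\<forall>f. doubly_L1 A f \<longrightarrow>
       Lp_norm \<infinity> (adjoint_L1 A (A f)) \<ge> ennreal k * Lp_norm \<infinity> f)"

text \<open>
  The value at \<open>q\<close> of an exponent given as an expression \<open>e\<close> in a finite \<open>q\<close>; at \<open>q = \<infinity>\<close> it is
  the limit of \<open>e\<close>.
\<close>

definition exponent_at :: "ennreal \<Rightarrow> (real \<Rightarrow> real) \<Rightarrow> real"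
  where "exponent_at q e = (if q = \<infinity> then Lim at_top e else e (enn2real q))"

end

theory Submission
  imports Defs
begin

text \<open>
  The inequality couples two facts about the quotient of the \<open>L\<^sup>1\<close> norm by the \<open>L\<^sup>q\<close> norm, which
  measures how widely a function is spread.

  The first fact says that \<open>f\<close> and \<open>A f\<close> cannot both be concentrated. The adjoint maps \<open>L\<^sup>1\<close> to
  \<open>L\<^sup>\<infinity>\<close> with norm at most \<open>1\<close>, like \<open>A\<close>, so the Hadamard property gives
  \<open>k * \<parallel>f\<parallel>\<^sub>\<infinity> \<le> \<parallel>A\<^sup>* A f\<parallel>\<^sub>\<infinity> \<le> \<parallel>A f\<parallel>\<^sub>1\<close>, while \<open>\<parallel>A f\<parallel>\<^sub>\<infinity> \<le> \<parallel>f\<parallel>\<^sub>1\<close> (lemma \<open>Hadamard_op_bounds\<close>).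
  Interpolating \<open>L\<^sup>q\<close> between \<open>L\<^sup>1\<close> and \<open>L\<^sup>\<infinity>\<close> (\<open>Lp_norm_interpolation\<close>) yields
  \<open>(\<parallel>f\<parallel>\<^sub>1 / \<parallel>f\<parallel>\<^sub>q) * (\<parallel>A f\<parallel>\<^sub>1 / \<parallel>A f\<parallel>\<^sub>q) \<ge> k powr (1 - 1/q)\<close>.

  The second fact says that a function with a small moment is concentrated (\<open>moment_lower_bound\<close>). The
  \<open>L\<^sup>1\<close> norm is split at a radius \<open>T\<close>: the part inside is at most a multiple of
  \<open>T powr (1 - 1/q) * \<parallel>f\<parallel>\<^sub>q\<close>, and the part outside is controlled by the moment, since
  \<open>\<bar>x\<bar> powr (- r)\<close> is integrable there. The radius at which the inside part is half of the norm gives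
  a lower bound for the moment in terms of \<open>\<parallel>f\<parallel>\<^sub>1 / \<parallel>f\<parallel>\<^sub>q\<close>. It involves one function only, so its constant
  depends on \<open>r\<close> and \<open>q\<close> alone. Applying it to \<open>f\<close> and to \<open>A f\<close> and multiplying proves the theorem.

  The adjoint is given by a choice among the functions satisfying the duality identity, so it has to
  be shown that there is one. This is the duality of \<open>L\<^sup>1\<close> and \<open>L\<^sup>\<infinity>\<close>
  (\<open>bounded_functional_representation\<close>), which is derived from the Radon--Nikodym theorem.
\<close>

section \<open>Bounded functionals on \<open>L\<^sup>1\<close>\<close>

text \<open>
  On the set where \<open>g < f\<close> the difference \<open>f - g\<close> is positive but has integral \<open>0\<close>. Finiteness of
  the integral of \<open>g\<close> is what allows the two integrals to be subtracted.
\<close>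

lemma AE_le_if_set_integral_le:
  fixes f g :: "'a \<Rightarrow> ennreal"
  assumes [measurable]: "f \<in> borel_measurable M" "g \<in> borel_measurable M"
    and le: "\<And>E. E \<in> sets M \<Longrightarrow> (\<integral>\<^sup>+x. f x * indicator E x \<partial>M) \<le> (\<integral>\<^sup>+x. g x * indicator E x \<partial>M)"
    and fin: "(\<integral>\<^sup>+x. g x \<partial>M) < \<infinity>"
  shows "AE x in M. f x \<le> g x"
proof -
  define E where "E = {x \<in> space M. g x < f x}"
  have [measurable]: "E \<in> sets M" unfolding E_def by measurable
  have "(\<integral>\<^sup>+x. g x * indicator E x \<partial>M) \<le> (\<integral>\<^sup>+x. g x \<partial>M)"
    by (intro nn_integral_mono) (auto simp: indicator_def)
  then have gfin: "(\<integral>\<^sup>+x. g x * indicator E x \<partial>M) < \<infinity>"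
    using fin by (rule le_less_trans)
  have "(\<integral>\<^sup>+x. (f x * indicator E x - g x * indicator E x) \<partial>M)
      = (\<integral>\<^sup>+x. f x * indicator E x \<partial>M) - (\<integral>\<^sup>+x. g x * indicator E x \<partial>M)"
    using gfin by (intro nn_integral_diff AE_I2) (auto simp: E_def indicator_def)
  also have "\<dots> = 0"
    using le[of E] gfin by (simp add: diff_eq_0_iff_ennreal)
  finally have "AE x in M. f x * indicator E x - g x * indicator E x = 0"
    by (subst (asm) nn_integral_0_iff_AE) auto
  then show ?thesis
  proof (rule AE_mp[OF _ AE_I2], intro impI)
    fix x assume x: "x \<in> space M" and z: "f x * indicator E x - g x * indicator E x = 0"
    show "f x \<le> g x"
    proof (rule ccontr)
      assume *: "\<not> f x \<le> g x"
      then have "f x - g x = 0" using z x by (auto simp: E_def not_le)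
      with * show False by (simp add: diff_eq_0_iff_ennreal)
    qed
  qed
qed

text \<open>
  The Radon--Nikodym theorem needs a nonnegative measure, whereas \<open>E \<mapsto> \<phi> (indicator E)\<close> is only a
  signed one. Adding \<open>B\<close> times the given measure makes it nonnegative, because \<open>\<phi>\<close> has norm at most
  \<open>B\<close>, and thus replaces the Hahn--Jordan decomposition. The sum \<open>\<nu>\<close> lies between \<open>0\<close> and \<open>2 * B\<close>
  times the given measure, so its density lies between \<open>0\<close> and \<open>2 * B\<close>, and subtracting \<open>B\<close> again
  gives a representing function bounded by \<open>B\<close>. The identity extends from indicators to all
  integrable functions by linearity and dominated convergence.
\<close>

lemma bounded_functional_representation_finite:
  fixes \<phi> :: "('a \<Rightarrow> real) \<Rightarrow> real"
  assumes "finite_measure M"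
    and plus: "\<And>f g. integrable M f \<Longrightarrow> integrable M g \<Longrightarrow> \<phi> (\<lambda>x. f x + g x) = \<phi> f + \<phi> g"
    and scale: "\<And>c f. integrable M f \<Longrightarrow> \<phi> (\<lambda>x. c * f x) = c * \<phi> f"
    and bound: "\<And>f. integrable M f \<Longrightarrow> \<bar>\<phi> f\<bar> \<le> B * (\<integral>x. \<bar>f x\<bar> \<partial>M)"
    and B: "0 \<le> B"
  shows "\<exists>h\<in>borel_measurable M. (\<forall>x. \<bar>h x\<bar> \<le> B) \<and>
    (\<forall>f. integrable M f \<longrightarrow> \<phi> f = (\<integral>x. f x * h x \<partial>M))"
proof -
  interpret finite_measure M by fact
  define \<nu> where "\<nu> E = \<phi> (indicator E) + B * measure M E" for E
  have int[simp]: "integrable M (indicator E :: 'a \<Rightarrow> real)" if "E \<in> sets M" for E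
    using that by (simp add: integrable_indicator_iff emeasure_finite less_top[symmetric])
  have bnd: "\<bar>\<phi> (indicator E)\<bar> \<le> B * measure M E" if "E \<in> sets M" for E
    using bound[OF int[OF that]] that by (simp add: sets.Int_space_eq2)
  have nonneg: "0 \<le> \<nu> E" and upper: "\<nu> E \<le> 2 * B * measure M E" if "E \<in> sets M" for E
    using bnd[OF that] by (auto simp: \<nu>_def)
  have \<nu>_empty: "\<nu> {} = 0"
    using upper[of "{}"] nonneg[of "{}"] by simp
  have \<nu>_add: "\<nu> (E \<union> F) = \<nu> E + \<nu> F" if "E \<in> sets M" "F \<in> sets M" "E \<inter> F = {}" for E F
  proof -
    have "(indicator (E \<union> F) :: 'a \<Rightarrow> real) = (\<lambda>x. indicator E x + indicator F x)"
      using that(3) by (auto simp: fun_eq_iff indicator_def)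
    then show ?thesis
      using that plus[OF int int, of E F] finite_measure_Union[of E F]
      by (simp add: \<nu>_def algebra_simps)
  qed
  define N where "N = measure_of (space M) (sets M) (\<lambda>E. ennreal (\<nu> E))"
  have sets_N[simp]: "sets N = sets M" and space_N[simp]: "space N = space M"
    by (simp_all add: N_def)
  have pos: "positive (sets M) (\<lambda>E. ennreal (\<nu> E))"
    by (simp add: positive_def \<nu>_empty)
  have ca: "countably_additive (sets M) (\<lambda>E. ennreal (\<nu> E))"
  proof (rule sets.empty_continuous_imp_countably_additive[OF pos])
    show "Measure_Space.additive (sets M) (\<lambda>E. ennreal (\<nu> E))"
      by (auto simp: additive_def \<nu>_add nonneg)
    show "\<forall>A\<in>sets M. ennreal (\<nu> A) \<noteq> \<infinity>" by simp
    fix A :: "nat \<Rightarrow> 'a set" assume A: "range A \<subseteq> sets M" "decseq A" "(\<Inter>i. A i) = {}"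
    have "(\<lambda>i. measure M (A i)) \<longlonglongrightarrow> measure M (\<Inter>i. A i)"
      using A by (intro finite_Lim_measure_decseq) auto
    then have "(\<lambda>i. measure M (A i)) \<longlonglongrightarrow> 0" by (simp add: A)
    from tendsto_mult_left[OF this, of "2 * B"]
    have lim: "(\<lambda>i. 2 * B * measure M (A i)) \<longlonglongrightarrow> 0" by simp
    have "A i \<in> sets M" for i using A(1) by auto
    then have "(\<lambda>i. \<nu> (A i)) \<longlonglongrightarrow> 0"
      by (intro tendsto_sandwich[OF _ _ tendsto_const lim] always_eventually allI nonneg upper)
    from tendsto_ennrealI[OF this] show "(\<lambda>i. ennreal (\<nu> (A i))) \<longlonglongrightarrow> 0" by simp
  qed
  have N: "emeasure N E = ennreal (\<nu> E)" if "E \<in> sets M" for E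
    using emeasure_measure_of_sigma[OF sets.sigma_algebra_axioms pos ca that] by (simp add: N_def)
  have "finite_measure N" by (rule finite_measureI) (simp add: N)
  moreover have "absolutely_continuous M N"
  proof -
    have "E \<in> null_sets N" if "E \<in> null_sets M" for E
      using that upper[of E] nonneg[of E] by (auto simp: null_sets_def N measure_def ennreal_neg)
    then show ?thesis by (auto simp: absolutely_continuous_def)
  qed
  ultimately obtain u where u[measurable]: "u \<in> borel_measurable M" and uN: "density M u = N"
    using Radon_Nikodym_finite_measure[of N] by auto
  have u_int: "(\<integral>\<^sup>+x. u x * indicator E x \<partial>M) = ennreal (\<nu> E)" if "E \<in> sets M" for E
    using that N[OF that] emeasure_density[OF u that] by (simp add: uN)
  have u_le: "AE x in M. u x \<le> ennreal (2 * B)"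
  proof (rule AE_le_if_set_integral_le)
    fix E assume E: "E \<in> sets M"
    have "ennreal (\<nu> E) \<le> ennreal (2 * B * measure M E)"
      using upper[OF E] by (rule ennreal_leI)
    also have "\<dots> = (\<integral>\<^sup>+x. ennreal (2 * B) * indicator E x \<partial>M)"
      using E B by (simp add: nn_integral_cmult_indicator emeasure_eq_measure ennreal_mult'[symmetric])
    finally show "(\<integral>\<^sup>+x. u x * indicator E x \<partial>M) \<le> (\<integral>\<^sup>+x. ennreal (2 * B) * indicator E x \<partial>M)"
      by (simp add: u_int E)
  next
    show "(\<integral>\<^sup>+x. ennreal (2 * B) \<partial>M) < \<infinity>"
      by (simp add: emeasure_eq_measure ennreal_mult_less_top)
  qed auto
  \<comment> \<open>Truncating at \<open>2 * B\<close> changes \<open>u\<close> only on a null set and makes the bound hold everywhere.\<close>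
  define h where "h x = min (enn2real (u x)) (2 * B) - B" for x
  have h[measurable]: "h \<in> borel_measurable M" unfolding h_def by measurable
  have h_bound: "\<bar>h x\<bar> \<le> B" for x
    using B enn2real_nonneg[of "u x"] unfolding h_def by linarith
  have h_int: "integrable M (\<lambda>x. f x * h x)" if "integrable M f" for f :: "'a \<Rightarrow> real"
  proof (rule Bochner_Integration.integrable_bound)
    show "integrable M (\<lambda>x. B * f x)" using that by simp
    show "(\<lambda>x. f x * h x) \<in> borel_measurable M" using that by measurable
    show "AE x in M. norm (f x * h x) \<le> norm (B * f x)"
      using h_bound B by (auto simp: abs_mult mult.commute[of B] intro!: mult_left_mono AE_I2)
  qed
  have ind: "\<phi> (indicator E) = (\<integral>x. indicator E x * h x \<partial>M)" if E[measurable]: "E \<in> sets M" for E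
  proof -
    have "(\<integral>x. indicator E x * (h x + B) \<partial>M) = enn2real (\<integral>\<^sup>+x. ennreal (indicator E x * (h x + B)) \<partial>M)"
      using B by (intro integral_eq_nn_integral AE_I2) (auto simp: h_def min_def)
    also have "(\<integral>\<^sup>+x. ennreal (indicator E x * (h x + B)) \<partial>M) = (\<integral>\<^sup>+x. u x * indicator E x \<partial>M)"
    proof (rule nn_integral_cong_AE, use u_le in eventually_elim)
      fix x assume le: "u x \<le> ennreal (2 * B)"
      then have "u x < top" by (rule le_less_trans) simp
      moreover have "enn2real (u x) \<le> 2 * B"
        using le B by (intro enn2real_leI) auto
      ultimately show "ennreal (indicator E x * (h x + B)) = u x * indicator E x"
        by (auto simp: h_def indicator_def)
    qed
    also have "enn2real \<dots> = \<nu> E" using nonneg[OF E] by (simp add: u_int)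
    finally have "(\<integral>x. indicator E x * (h x + B) \<partial>M) = \<nu> E" .
    moreover have "(\<integral>x. indicator E x * (h x + B) \<partial>M)
        = (\<integral>x. indicator E x * h x \<partial>M) + (\<integral>x. indicator E x * B \<partial>M)"
      by (subst Bochner_Integration.integral_add[symmetric])
        (auto intro!: h_int simp: distrib_left)
    ultimately show ?thesis
      by (simp add: \<nu>_def sets.Int_space_eq2)
  qed
  have "\<phi> f = (\<integral>x. f x * h x \<partial>M)" if "integrable M f" for f
    using that
  proof (induction rule: integrable_induct)
    case (base A c)
    have "\<phi> (\<lambda>x. indicator A x *\<^sub>R c) = c * \<phi> (indicator A)"
      using scale[OF int[OF base(1)], of c] by (simp add: mult.commute)
    also have "\<dots> = (\<integral>x. indicator A x *\<^sub>R c * h x \<partial>M)"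
      unfolding ind[OF base(1)] by (subst integral_mult_right_zero[symmetric]) (simp add: ac_simps)
    finally show ?case .
  next
    case (add f g)
    then show ?case
      by (simp add: plus distrib_right h_int)
  next
    case (lim f s)
    have f: "integrable M f" and s: "\<And>i. integrable M (s i)"
      and conv: "\<And>x. x \<in> space M \<Longrightarrow> (\<lambda>i. s i x) \<longlonglongrightarrow> f x"
      and dom: "\<And>i x. x \<in> space M \<Longrightarrow> norm (s i x) \<le> 2 * norm (f x)"
      and IH: "\<And>i. \<phi> (s i) = (\<integral>x. s i x * h x \<partial>M)"
      by fact+
    have [measurable]: "f \<in> borel_measurable M" "\<And>i. s i \<in> borel_measurable M"
      using f s by auto
    have "(\<lambda>i. \<integral>x. \<bar>s i x - f x\<bar> \<partial>M) \<longlonglongrightarrow> (\<integral>x. 0 \<partial>M)"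
    proof (rule integral_dominated_convergence)
      show "integrable M (\<lambda>x. 3 * \<bar>f x\<bar>)" using f by simp
      show "AE x in M. (\<lambda>i. \<bar>s i x - f x\<bar>) \<longlonglongrightarrow> 0"
        by (intro AE_I2 tendsto_rabs_zero LIM_zero conv)
      show "AE x in M. norm \<bar>s i x - f x\<bar> \<le> 3 * \<bar>f x\<bar>" for i
      proof (rule AE_I2)
        fix x assume "x \<in> space M"
        from dom[OF this, of i] show "norm \<bar>s i x - f x\<bar> \<le> 3 * \<bar>f x\<bar>" by simp
      qed
    qed auto
    then have "(\<lambda>i. B * (\<integral>x. \<bar>s i x - f x\<bar> \<partial>M)) \<longlonglongrightarrow> 0"
      by (intro tendsto_mult_right_zero) simp
    then have "(\<lambda>i. \<phi> (s i) - \<phi> f) \<longlonglongrightarrow> 0"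
    proof (rule Lim_null_comparison[rotated], intro always_eventually allI)
      fix i
      have eq: "\<phi> (\<lambda>x. s i x + (-1) * f x) = \<phi> (s i) + (-1) * \<phi> f"
        using scale[OF f, of "-1"] plus[OF s, of "\<lambda>x. (-1) * f x" i] f by simp
      have "integrable M (\<lambda>x. s i x + (-1) * f x)" using f s by simp
      from bound[OF this] eq show "norm (\<phi> (s i) - \<phi> f) \<le> B * (\<integral>x. \<bar>s i x - f x\<bar> \<partial>M)"
        by simp
    qed
    then have "(\<lambda>i. \<phi> (s i)) \<longlonglongrightarrow> \<phi> f" by (rule LIM_zero_cancel)
    moreover have "(\<lambda>i. \<phi> (s i)) \<longlonglongrightarrow> (\<integral>x. f x * h x \<partial>M)"
      unfolding IH
    proof (rule integral_dominated_convergence)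
      show "integrable M (\<lambda>x. 2 * \<bar>f x\<bar> * B)" using f by simp
      show "AE x in M. (\<lambda>i. s i x * h x) \<longlonglongrightarrow> f x * h x"
        by (intro AE_I2 tendsto_mult_right conv)
      show "AE x in M. norm (s i x * h x) \<le> 2 * \<bar>f x\<bar> * B" for i
      proof (rule AE_I2)
        fix x assume "x \<in> space M"
        from dom[OF this, of i] show "norm (s i x * h x) \<le> 2 * \<bar>f x\<bar> * B"
          unfolding norm_mult by (intro mult_mono) (auto simp: h_bound)
      qed
    qed auto
    ultimately show ?case by (rule LIMSEQ_unique)
  qed
  then show ?thesis using h h_bound by blast
qed

text \<open>
  A strictly positive integrable weight \<open>w\<close> turns the measure into a finite one, and \<open>f \<mapsto> w * f\<close>
  is an isometry between the two spaces of integrable functions, so the bound \<open>B\<close> is unaffected.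
\<close>

lemma bounded_functional_representation:
  fixes \<phi> :: "('a \<Rightarrow> real) \<Rightarrow> real"
  assumes "sigma_finite_measure M"
    and plus: "\<And>f g. integrable M f \<Longrightarrow> integrable M g \<Longrightarrow> \<phi> (\<lambda>x. f x + g x) = \<phi> f + \<phi> g"
    and scale: "\<And>c f. integrable M f \<Longrightarrow> \<phi> (\<lambda>x. c * f x) = c * \<phi> f"
    and bound: "\<And>f. integrable M f \<Longrightarrow> \<bar>\<phi> f\<bar> \<le> B * (\<integral>x. \<bar>f x\<bar> \<partial>M)"
    and B: "0 \<le> B"
  shows "\<exists>h\<in>borel_measurable M. (\<forall>x. \<bar>h x\<bar> \<le> B) \<and>
    (\<forall>f. integrable M f \<longrightarrow> \<phi> f = (\<integral>x. f x * h x \<partial>M))"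
proof -
  interpret sigma_finite_measure M by fact
  obtain w0 where w0[measurable]: "w0 \<in> borel_measurable M" and w0_fin: "integral\<^sup>N M w0 \<noteq> \<infinity>"
    and w0_pos: "\<And>x. x \<in> space M \<Longrightarrow> 0 < w0 x \<and> w0 x < \<infinity>"
    using Ex_finite_integrable_function by auto
  \<comment> \<open>The weight is positive outside the space as well, so that dividing by it can be undone as an
    identity of functions: nothing is known about \<open>\<phi>\<close> on functions that agree only on the space.\<close>
  define w where "w x = (if x \<in> space M then enn2real (w0 x) else 1)" for x
  have w[measurable]: "w \<in> borel_measurable M"
    using measurable_cong[of M w "\<lambda>x. enn2real (w0 x)"] by (simp add: w_def)
  have w_pos: "0 < w x" for x
    using w0_pos by (auto simp: w_def enn2real_positive_iff)
  have w_nonneg: "AE x in M. 0 \<le> w x" using w_pos by (auto intro: less_imp_le)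
  define D where "D = density M (\<lambda>x. ennreal (w x))"
  have "finite_measure D"
  proof (rule finite_measureI)
    have "emeasure D (space D) = integral\<^sup>N M w0"
      unfolding D_def by (subst emeasure_density)
        (use w0_pos in \<open>auto intro!: nn_integral_cong simp: w_def less_top\<close>)
    then show "emeasure D (space D) \<noteq> \<infinity>" using w0_fin by simp
  qed
  have D_int: "integrable M (\<lambda>x. w x * f x)" if "integrable D f" for f :: "'a \<Rightarrow> real"
  proof -
    have [measurable]: "f \<in> borel_measurable M" using that by (auto simp: D_def)
    show ?thesis using that unfolding D_def by (subst (asm) integrable_density) (auto simp: w_nonneg)
  qed
  from \<open>finite_measure D\<close> have "\<exists>h\<in>borel_measurable D. (\<forall>x. \<bar>h x\<bar> \<le> B) \<and>
    (\<forall>f. integrable D f \<longrightarrow> \<phi> (\<lambda>x. w x * f x) = (\<integral>x. f x * h x \<partial>D))"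
  proof (rule bounded_functional_representation_finite)
    show "\<phi> (\<lambda>x. w x * (f x + g x)) = \<phi> (\<lambda>x. w x * f x) + \<phi> (\<lambda>x. w x * g x)"
      if "integrable D f" "integrable D g" for f g
      using plus[OF D_int D_int] that by (simp add: distrib_left)
    show "\<phi> (\<lambda>x. w x * (c * f x)) = c * \<phi> (\<lambda>x. w x * f x)" if "integrable D f" for c f
      using scale[OF D_int, of f c] that by (simp add: mult.left_commute)
    show "\<bar>\<phi> (\<lambda>x. w x * f x)\<bar> \<le> B * (\<integral>x. \<bar>f x\<bar> \<partial>D)" if "integrable D f" for f
    proof -
      have [measurable]: "f \<in> borel_measurable M" using that by (auto simp: D_def)
      have "(\<integral>x. \<bar>w x * f x\<bar> \<partial>M) = (\<integral>x. \<bar>f x\<bar> \<partial>D)"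
        unfolding D_def using w_pos by (subst integral_density) (auto simp: abs_mult abs_of_pos w_nonneg)
      then show ?thesis using bound[OF D_int[OF that]] by simp
    qed
  qed (rule B)
  then obtain h where h: "h \<in> borel_measurable D" "\<And>x. \<bar>h x\<bar> \<le> B"
    and rep: "\<And>f. integrable D f \<Longrightarrow> \<phi> (\<lambda>x. w x * f x) = (\<integral>x. f x * h x \<partial>D)"
    by auto
  have [measurable]: "h \<in> borel_measurable M" using h(1) by (simp add: D_def)
  have "\<phi> f = (\<integral>x. f x * h x \<partial>M)" if f: "integrable M f" for f
  proof -
    have [measurable]: "f \<in> borel_measurable M" using f by auto
    have cancel: "w x * (f x / w x) = f x" "w x * (f x / w x * h x) = f x * h x" for x
      using w_pos[of x] by auto
    have "integrable D (\<lambda>x. f x / w x)"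
      unfolding D_def by (subst integrable_density) (use f cancel in \<open>auto simp: w_nonneg\<close>)
    from rep[OF this] have "\<phi> f = (\<integral>x. f x / w x * h x \<partial>D)" by (simp only: cancel)
    also have "\<dots> = (\<integral>x. f x * h x \<partial>M)"
      unfolding D_def by (subst integral_density) (use cancel in \<open>auto simp: w_nonneg\<close>)
    finally show ?thesis .
  qed
  then show ?thesis using h(2) \<open>h \<in> borel_measurable M\<close> by blast
qed

section \<open>The adjoint of a contraction from \<open>L\<^sup>1\<close> to \<open>L\<^sup>\<infinity>\<close>\<close>

lemma sigma_finite_lebesgue: "sigma_finite_measure (lebesgue :: real measure)"
proof
  show "\<exists>A::real set set. countable A \<and> A \<subseteq> sets lebesgue \<and> \<Union> A = space lebesgue \<and>
      (\<forall>a\<in>A. emeasure lebesgue a \<noteq> \<infinity>)"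
  proof (intro exI conjI)
    show "countable (range (\<lambda>n::nat. {- real n..real n}))" by simp
    show "\<Union> (range (\<lambda>n::nat. {- real n..real n})) = space lebesgue"
    proof -
      have "\<exists>n::nat. - real n \<le> x \<and> x \<le> real n" for x
        using real_arch_simple[of "\<bar>x\<bar>"] by (metis abs_le_iff minus_le_iff)
      then show ?thesis by auto
    qed
  qed auto
qed

lemma borel_measurable_cnj[measurable (raw)]:
  "g \<in> borel_measurable M \<Longrightarrow> (\<lambda>x. cnj (g x)) \<in> borel_measurable M"
  by (rule borel_measurable_continuous_on[OF continuous_on_cnj[OF continuous_on_id]])

lemma Lp_norm_1:
  assumes "integrable lebesgue f"
  shows "Lp_norm 1 f = ennreal (\<integral>x. cmod (f x) \<partial>lebesgue)"
proof -
  have "(\<integral>\<^sup>+x. ennreal (cmod (f x) powr 1) \<partial>lebesgue) = ennreal (\<integral>x. cmod (f x) \<partial>lebesgue)"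
    using assms by (simp add: nn_integral_eq_integral)
  then show ?thesis by (simp add: Lp_norm_def epowr_def)
qed

lemma AE_le_Lp_norm_inf: "AE x in lebesgue. ennreal (cmod (f x)) \<le> Lp_norm \<infinity> f"
  unfolding Lp_norm_def by (simp add: esssup_AE)

lemma Lp_norm_inf_le:
  assumes "f \<in> borel_measurable lebesgue" "AE x in lebesgue. cmod (f x) \<le> c"
  shows "Lp_norm \<infinity> f \<le> ennreal c"
proof -
  have "AE x in lebesgue. ennreal (cmod (f x)) \<le> ennreal c"
    using assms(2) by eventually_elim (rule ennreal_leI)
  then show ?thesis unfolding Lp_norm_def using assms(1) by (auto intro!: esssup_I)
qed

locale L1_Linf_contraction =
  fixes A :: "(real \<Rightarrow> complex) \<Rightarrow> real \<Rightarrow> complex"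
  assumes linear: "linear_L1_Linf A"
    and contraction: "\<And>f. f \<in> L1_space \<Longrightarrow> Lp_norm \<infinity> (A f) \<le> Lp_norm 1 f"
begin

lemma A_measurable: "integrable lebesgue f \<Longrightarrow> A f \<in> borel_measurable lebesgue"
  using linear by (auto simp: linear_L1_Linf_def L1_space_def Linf_space_def)

lemma A_bound:
  assumes "integrable lebesgue f"
  shows "AE x in lebesgue. cmod (A f x) \<le> (\<integral>x. cmod (f x) \<partial>lebesgue)"
proof -
  have "Lp_norm \<infinity> (A f) \<le> ennreal (\<integral>x. cmod (f x) \<partial>lebesgue)"
    using contraction[of f] assms by (simp add: L1_space_def Lp_norm_1)
  then have "ennreal (cmod (A f x)) \<le> Lp_norm \<infinity> (A f) \<Longrightarrow> cmod (A f x) \<le> (\<integral>x. cmod (f x) \<partial>lebesgue)" for x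
    using order.trans ennreal_le_iff[of "\<integral>x. cmod (f x) \<partial>lebesgue"] by fastforce
  with AE_le_Lp_norm_inf[of "A f"] show ?thesis by (rule eventually_mono)
qed

lemma pairing_integrable:
  assumes f: "integrable lebesgue f" and g: "integrable lebesgue g"
  shows "integrable lebesgue (\<lambda>x. A f x * cnj (g x))"
proof (rule Bochner_Integration.integrable_bound)
  show "integrable lebesgue (\<lambda>x. (\<integral>x. cmod (f x) \<partial>lebesgue) * cmod (g x))" using g by simp
  show "(\<lambda>x. A f x * cnj (g x)) \<in> borel_measurable lebesgue"
    by (intro borel_measurable_times borel_measurable_cnj borel_measurable_integrable[OF g] A_measurable f)
  show "AE x in lebesgue. norm (A f x * cnj (g x)) \<le> norm ((\<integral>x. cmod (f x) \<partial>lebesgue) * cmod (g x))"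
    using A_bound[OF f] by eventually_elim (auto simp: norm_mult intro!: mult_right_mono)
qed

lemma pairing_bound:
  assumes f: "integrable lebesgue f" and g: "integrable lebesgue g"
  shows "cmod (\<integral>x. A f x * cnj (g x) \<partial>lebesgue)
    \<le> (\<integral>x. cmod (g x) \<partial>lebesgue) * (\<integral>x. cmod (f x) \<partial>lebesgue)"
proof -
  have "cmod (\<integral>x. A f x * cnj (g x) \<partial>lebesgue) \<le> (\<integral>x. cmod (A f x * cnj (g x)) \<partial>lebesgue)"
    by (rule integral_norm_bound)
  also have "\<dots> \<le> (\<integral>x. (\<integral>x. cmod (f x) \<partial>lebesgue) * cmod (g x) \<partial>lebesgue)"
  proof (rule integral_mono_AE)
    show "AE x in lebesgue. cmod (A f x * cnj (g x)) \<le> (\<integral>x. cmod (f x) \<partial>lebesgue) * cmod (g x)"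
      using A_bound[OF f] by eventually_elim (auto simp: norm_mult intro!: mult_right_mono)
  qed (use pairing_integrable[OF f g] g in auto)
  finally show ?thesis by (simp add: mult.commute)
qed

lemma pairing_add:
  assumes "integrable lebesgue f1" "integrable lebesgue f2" and g: "integrable lebesgue g"
  shows "(\<integral>x. A (\<lambda>y. f1 y + f2 y) x * cnj (g x) \<partial>lebesgue)
    = (\<integral>x. A f1 x * cnj (g x) \<partial>lebesgue) + (\<integral>x. A f2 x * cnj (g x) \<partial>lebesgue)"
proof -
  have "AE x in lebesgue. A (\<lambda>y. f1 y + f2 y) x = A f1 x + A f2 x"
    using linear assms by (auto simp: linear_L1_Linf_def L1_space_def)
  then have "(\<integral>x. A (\<lambda>y. f1 y + f2 y) x * cnj (g x) \<partial>lebesgue)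
      = (\<integral>x. A f1 x * cnj (g x) + A f2 x * cnj (g x) \<partial>lebesgue)"
    using assms by (intro integral_cong_AE)
      (auto intro!: borel_measurable_times borel_measurable_add borel_measurable_cnj A_measurable simp: distrib_right)
  then show ?thesis
    using assms by (simp add: pairing_integrable)
qed

lemma pairing_scale:
  assumes f: "integrable lebesgue f" and g: "integrable lebesgue g"
  shows "(\<integral>x. A (\<lambda>y. c * f y) x * cnj (g x) \<partial>lebesgue) = c * (\<integral>x. A f x * cnj (g x) \<partial>lebesgue)"
proof -
  have "AE x in lebesgue. A (\<lambda>y. c * f y) x = c * A f x"
    using linear assms by (auto simp: linear_L1_Linf_def L1_space_def)
  then have "(\<integral>x. A (\<lambda>y. c * f y) x * cnj (g x) \<partial>lebesgue)
      = (\<integral>x. c * (A f x * cnj (g x)) \<partial>lebesgue)"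
    using assms by (intro integral_cong_AE)
      (auto intro!: borel_measurable_times borel_measurable_const borel_measurable_cnj A_measurable)
  then show ?thesis by simp
qed

text \<open>
  The functional \<open>f \<mapsto> \<integral> A f * cnj g\<close> is bounded on complex \<open>L\<^sup>1\<close>. Restricted to real functions, its
  real and imaginary parts are bounded real functionals with representing functions \<open>a\<close> and \<open>b\<close>; by
  complex linearity the functional itself is represented by \<open>a + \<i> * b\<close>, the conjugate of \<open>h\<close>. The
  crude bound \<open>2 * B\<close> puts \<open>h\<close> into \<open>L\<^sup>\<infinity>\<close>; the next lemma recovers the sharp one from the identity.
\<close>

lemma adjoint_exists:
  assumes g: "integrable lebesgue g"
  shows "\<exists>h. h \<in> Linf_space \<and> (\<forall>f\<in>L1_space.
    (LINT x|lebesgue. A f x * cnj (g x)) = (LINT x|lebesgue. f x * cnj (h x)))"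
proof -
  define B where "B = (\<integral>x. cmod (g x) \<partial>lebesgue)"
  have B: "0 \<le> B" by (simp add: B_def)
  define \<Lambda> where "\<Lambda> f = (\<integral>x. A f x * cnj (g x) \<partial>lebesgue)" for f
  have \<Lambda>_add: "\<Lambda> (\<lambda>x. f1 x + f2 x) = \<Lambda> f1 + \<Lambda> f2"
    if "integrable lebesgue f1" "integrable lebesgue f2" for f1 f2
    using pairing_add[OF that g] by (simp add: \<Lambda>_def)
  have \<Lambda>_scale: "\<Lambda> (\<lambda>x. c * f x) = c * \<Lambda> f" if "integrable lebesgue f" for c f
    using pairing_scale[OF that g] by (simp add: \<Lambda>_def)
  have \<Lambda>_bound: "cmod (\<Lambda> f) \<le> B * (\<integral>x. cmod (f x) \<partial>lebesgue)" if "integrable lebesgue f" for f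
    using pairing_bound[OF that g] by (simp add: \<Lambda>_def B_def)
  have real_rep: "\<exists>h\<in>borel_measurable lebesgue. (\<forall>x. \<bar>h x\<bar> \<le> B) \<and>
      (\<forall>u. integrable lebesgue u \<longrightarrow> p (\<Lambda> (\<lambda>x. complex_of_real (u x))) = (\<integral>x. u x * h x \<partial>lebesgue))"
    if p: "p = Re \<or> p = Im" for p :: "complex \<Rightarrow> real"
  proof (rule bounded_functional_representation[OF sigma_finite_lebesgue _ _ _ B])
    show "p (\<Lambda> (\<lambda>x. complex_of_real (u x + v x)))
        = p (\<Lambda> (\<lambda>x. complex_of_real (u x))) + p (\<Lambda> (\<lambda>x. complex_of_real (v x)))"
      if "integrable lebesgue u" "integrable lebesgue v" for u v
      using that p \<Lambda>_add[of "\<lambda>x. complex_of_real (u x)" "\<lambda>x. complex_of_real (v x)"] by auto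
    show "p (\<Lambda> (\<lambda>x. complex_of_real (c * u x))) = c * p (\<Lambda> (\<lambda>x. complex_of_real (u x)))"
      if "integrable lebesgue u" for c u
      using that p \<Lambda>_scale[of "\<lambda>x. complex_of_real (u x)" "complex_of_real c"] by auto
    show "\<bar>p (\<Lambda> (\<lambda>x. complex_of_real (u x)))\<bar> \<le> B * (\<integral>x. \<bar>u x\<bar> \<partial>lebesgue)"
      if "integrable lebesgue u" for u
      using p \<Lambda>_bound[of "\<lambda>x. complex_of_real (u x)"] that
        abs_Re_le_cmod[of "\<Lambda> (\<lambda>x. complex_of_real (u x))"]
        abs_Im_le_cmod[of "\<Lambda> (\<lambda>x. complex_of_real (u x))"] by auto
  qed
  obtain a where a[measurable]: "a \<in> borel_measurable lebesgue" and a_le: "\<And>x. \<bar>a x\<bar> \<le> B"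
    and a_rep: "\<And>u. integrable lebesgue u \<Longrightarrow>
      Re (\<Lambda> (\<lambda>x. complex_of_real (u x))) = (\<integral>x. u x * a x \<partial>lebesgue)"
    using real_rep[of Re] by auto
  obtain b where b[measurable]: "b \<in> borel_measurable lebesgue" and b_le: "\<And>x. \<bar>b x\<bar> \<le> B"
    and b_rep: "\<And>u. integrable lebesgue u \<Longrightarrow>
      Im (\<Lambda> (\<lambda>x. complex_of_real (u x))) = (\<integral>x. u x * b x \<partial>lebesgue)"
    using real_rep[of Im] by auto
  define h where "h x = Complex (a x) (- b x)" for x
  have h_eq: "h = (\<lambda>x. complex_of_real (a x) - \<i> * complex_of_real (b x))"
    by (auto simp: h_def complex_eq_iff fun_eq_iff)
  have h[measurable]: "h \<in> borel_measurable lebesgue"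
    unfolding h_eq by measurable
  have h_le: "cmod (h x) \<le> 2 * B" for x
    using cmod_le[of "h x"] a_le[of x] b_le[of x] by (simp add: h_def)
  have prod_int: "integrable lebesgue (\<lambda>x. u x * c x)"
    if "integrable lebesgue u" "c \<in> borel_measurable lebesgue" "\<And>x. \<bar>c x\<bar> \<le> B" for u c :: "real \<Rightarrow> real"
  proof (rule Bochner_Integration.integrable_bound)
    show "integrable lebesgue (\<lambda>x. B * u x)" using that by simp
    show "(\<lambda>x. u x * c x) \<in> borel_measurable lebesgue" using that by auto
    show "AE x in lebesgue. norm (u x * c x) \<le> norm (B * u x)"
      using that(3) B by (intro AE_I2) (auto simp: abs_mult mult.commute[of B] intro!: mult_left_mono)
  qed
  have real_case: "\<Lambda> (\<lambda>x. complex_of_real (u x)) = (\<integral>x. complex_of_real (u x) * cnj (h x) \<partial>lebesgue)"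
      and real_int: "integrable lebesgue (\<lambda>x. complex_of_real (u x) * cnj (h x))"
    if u: "integrable lebesgue u" for u
  proof -
    have i: "integrable lebesgue (\<lambda>x. complex_of_real (u x * a x))"
      "integrable lebesgue (\<lambda>x. complex_of_real (u x * b x))"
      using prod_int[OF u a a_le] prod_int[OF u b b_le] by (auto simp del: of_real_mult)
    have eq: "(\<lambda>x. complex_of_real (u x) * cnj (h x))
        = (\<lambda>x. complex_of_real (u x * a x) + \<i> * complex_of_real (u x * b x))"
      by (auto simp: h_def complex_eq_iff)
    show "integrable lebesgue (\<lambda>x. complex_of_real (u x) * cnj (h x))"
      unfolding eq using i by (intro Bochner_Integration.integrable_add integrable_mult_right)
    have "(\<integral>x. complex_of_real (u x) * cnj (h x) \<partial>lebesgue)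
        = complex_of_real (\<integral>x. u x * a x \<partial>lebesgue) + \<i> * complex_of_real (\<integral>x. u x * b x \<partial>lebesgue)"
      unfolding eq using i
      by (subst Bochner_Integration.integral_add) (auto simp del: of_real_mult)
    then show "\<Lambda> (\<lambda>x. complex_of_real (u x)) = (\<integral>x. complex_of_real (u x) * cnj (h x) \<partial>lebesgue)"
      by (simp add: complex_eq_iff a_rep[OF u] b_rep[OF u])
  qed
  have "\<Lambda> f = (\<integral>x. f x * cnj (h x) \<partial>lebesgue)" if f: "integrable lebesgue f" for f
  proof -
    have Re: "integrable lebesgue (\<lambda>x. Re (f x))" and Im: "integrable lebesgue (\<lambda>x. Im (f x))"
      using f by auto
    have "\<Lambda> f = \<Lambda> (\<lambda>x. complex_of_real (Re (f x)) + \<i> * complex_of_real (Im (f x)))"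
      by (simp add: complex_eq[symmetric])
    also have "\<dots> = \<Lambda> (\<lambda>x. complex_of_real (Re (f x))) + \<i> * \<Lambda> (\<lambda>x. complex_of_real (Im (f x)))"
      using Re Im by (simp add: \<Lambda>_add \<Lambda>_scale)
    also have "\<dots> = (\<integral>x. complex_of_real (Re (f x)) * cnj (h x)
        + \<i> * (complex_of_real (Im (f x)) * cnj (h x)) \<partial>lebesgue)"
      unfolding real_case[OF Re] real_case[OF Im]
      using real_int[OF Re] real_int[OF Im] by simp
    also have "\<dots> = (\<integral>x. f x * cnj (h x) \<partial>lebesgue)"
      by (intro arg_cong[where f="integral\<^sup>L lebesgue"] ext)
        (subst (3) complex_eq, simp add: distrib_right mult.assoc)
    finally show ?thesis .
  qed
  moreover have "h \<in> Linf_space"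
    using Lp_norm_inf_le[OF h AE_I2, of "2 * B"] h h_le
    by (auto simp: Linf_space_def intro: le_less_trans)
  ultimately show ?thesis by (auto simp: \<Lambda>_def L1_space_def)
qed

text \<open>
  This is the estimate of the norm of the adjoint as an operator from \<open>L\<^sup>1\<close> to \<open>L\<^sup>\<infinity>\<close>. It is derived
  from the defining identity alone, so it holds for whichever adjoint function was chosen. Testing
  the identity on \<open>f = indicator S * sgn h\<close> turns the right side into the integral of \<open>cmod h\<close> over
  \<open>S\<close>, and the left side is at most the \<open>L\<^sup>1\<close> norm of \<open>g\<close> times the measure of \<open>S\<close>. So the averages
  of \<open>cmod h\<close> are bounded by that norm. The line is exhausted by the intervals \<open>{- n..n}\<close> to keep
  the test functions integrable.
\<close>

lemma adjoint_bound:
  assumes g: "integrable lebesgue g"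
  shows "Lp_norm \<infinity> (adjoint_L1 A g) \<le> Lp_norm 1 g"
proof -
  define h where "h = adjoint_L1 A g"
  have "h \<in> Linf_space \<and> (\<forall>f\<in>L1_space.
      (LINT x|lebesgue. A f x * cnj (g x)) = (LINT x|lebesgue. f x * cnj (h x)))"
    unfolding h_def adjoint_L1_def by (rule someI_ex[OF adjoint_exists[OF g]])
  then have h[measurable]: "h \<in> borel_measurable lebesgue"
    and adj: "\<And>f. integrable lebesgue f \<Longrightarrow>
      (LINT x|lebesgue. A f x * cnj (g x)) = (LINT x|lebesgue. f x * cnj (h x))"
    and h_inf: "Lp_norm \<infinity> h < \<infinity>"
    by (auto simp: Linf_space_def L1_space_def)
  define B where "B = (\<integral>x. cmod (g x) \<partial>lebesgue)"
  have B: "0 \<le> B" by (simp add: B_def)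
  define K where "K = enn2real (Lp_norm \<infinity> h)"
  have K: "AE x in lebesgue. cmod (h x) \<le> K"
    using AE_le_Lp_norm_inf[of h]
  proof eventually_elim
    fix x assume "ennreal (cmod (h x)) \<le> Lp_norm \<infinity> h"
    also have "Lp_norm \<infinity> h = ennreal K" using h_inf by (simp add: K_def)
    finally show "cmod (h x) \<le> K" by (simp add: K_def)
  qed
  have loc: "AE x in lebesgue. ennreal (cmod (h x)) * indicator {- real n..real n} x
      \<le> ennreal B * indicator {- real n..real n} x" for n :: nat
  proof (rule AE_le_if_set_integral_le)
    fix E :: "real set" assume E[measurable]: "E \<in> sets lebesgue"
    define S where "S = {- real n..real n} \<inter> E"
    have S[measurable]: "S \<in> sets lebesgue" unfolding S_def using E by (intro sets.Int) auto
    have S_fin: "emeasure lebesgue S < \<infinity>"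
      using emeasure_mono[of S "{- real n..real n}" lebesgue]
      by (auto simp: S_def intro: le_less_trans)
    define f where "f x = indicator S x * sgn (h x)" for x
    have S_int: "integrable lebesgue (indicator S :: real \<Rightarrow> real)"
      using S S_fin by (simp add: integrable_indicator_iff)
    have f_le: "norm (f x) \<le> indicator S x" for x
      by (simp add: f_def norm_mult norm_sgn indicator_def)
    have f: "integrable lebesgue f"
    proof (rule Bochner_Integration.integrable_bound)
      show "integrable lebesgue (indicator S :: real \<Rightarrow> real)" by (rule S_int)
      show "f \<in> borel_measurable lebesgue" unfolding f_def sgn_div_norm by measurable
      show "AE x in lebesgue. norm (f x) \<le> norm (indicator S x :: real)"
        using f_le by (auto intro!: AE_I2)
    qed
    have fh: "f x * cnj (h x) = complex_of_real (indicator S x * cmod (h x))" for x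
    proof -
      have "sgn z * cnj z = complex_of_real (cmod z)" for z
        by (cases "z = 0") (simp_all add: sgn_eq complex_norm_square[symmetric] power2_eq_square)
      then show ?thesis by (simp add: f_def indicator_def)
    qed
    have int: "integrable lebesgue (\<lambda>x. indicator S x * cmod (h x))"
    proof (rule Bochner_Integration.integrable_bound)
      show "integrable lebesgue (\<lambda>x. indicator S x * K)" using S S_fin by simp
      show "AE x in lebesgue. norm (indicator S x * cmod (h x)) \<le> norm (indicator S x * K)"
        using K by eventually_elim (auto simp: indicator_def)
    qed auto
    have "(\<integral>x. indicator S x * cmod (h x) \<partial>lebesgue) = cmod (\<integral>x. f x * cnj (h x) \<partial>lebesgue)"
      unfolding fh integral_complex_of_real by simp
    also have "\<dots> \<le> B * (\<integral>x. cmod (f x) \<partial>lebesgue)"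
      unfolding adj[OF f, symmetric] B_def by (rule pairing_bound[OF f g])
    also have "\<dots> \<le> B * (\<integral>x. indicator S x \<partial>lebesgue)"
      by (intro mult_left_mono integral_mono integrable_norm f S_int f_le B)
    finally have le: "(\<integral>x. indicator S x * cmod (h x) \<partial>lebesgue) \<le> B * measure lebesgue S"
      by simp
    have "(\<integral>\<^sup>+x. ennreal (cmod (h x)) * indicator {- real n..real n} x * indicator E x \<partial>lebesgue)
        = (\<integral>\<^sup>+x. ennreal (indicator S x * cmod (h x)) \<partial>lebesgue)"
      by (intro nn_integral_cong) (auto simp: S_def indicator_def)
    also have "\<dots> = ennreal (\<integral>x. indicator S x * cmod (h x) \<partial>lebesgue)"
      by (intro nn_integral_eq_integral int) auto
    also have "\<dots> \<le> ennreal (B * measure lebesgue S)" by (rule ennreal_leI[OF le])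
    also have "\<dots> = (\<integral>\<^sup>+x. ennreal B * indicator S x \<partial>lebesgue)"
      using S S_fin B by (simp add: nn_integral_cmult_indicator ennreal_mult emeasure_eq_ennreal_measure less_top)
    also have "\<dots> = (\<integral>\<^sup>+x. ennreal B * indicator {- real n..real n} x * indicator E x \<partial>lebesgue)"
      by (intro nn_integral_cong) (auto simp: S_def indicator_def)
    finally show "(\<integral>\<^sup>+x. ennreal (cmod (h x)) * indicator {- real n..real n} x * indicator E x \<partial>lebesgue)
        \<le> (\<integral>\<^sup>+x. ennreal B * indicator {- real n..real n} x * indicator E x \<partial>lebesgue)" .
  next
    show "(\<integral>\<^sup>+x. ennreal B * indicator {- real n..real n} x \<partial>lebesgue) < \<infinity>"
      by (simp add: nn_integral_cmult_indicator ennreal_mult_less_top)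
  qed (intro borel_measurable_times_ennreal borel_measurable_const borel_measurable_indicator; simp)+
  have "AE x in lebesgue. \<forall>n::nat. ennreal (cmod (h x)) * indicator {- real n..real n} x
      \<le> ennreal B * indicator {- real n..real n} x"
    unfolding AE_all_countable using loc by blast
  then have "AE x in lebesgue. cmod (h x) \<le> B"
  proof eventually_elim
    fix x assume *: "\<forall>n::nat. ennreal (cmod (h x)) * indicator {- real n..real n} x
      \<le> ennreal B * indicator {- real n..real n} x"
    obtain n :: nat where "\<bar>x\<bar> \<le> real n" using real_arch_simple by blast
    with *[rule_format, of n] B show "cmod (h x) \<le> B"
      by (auto simp: indicator_def abs_le_iff split: if_splits)
  qed
  from Lp_norm_inf_le[OF h this] show ?thesis
    using g by (simp add: Lp_norm_1 h_def B_def)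
qed

end

section \<open>Moments and \<open>L\<^sup>q\<close> norms\<close>

text \<open>
  The reciprocal \<open>1 - 1/q\<close> of the exponent conjugate to \<open>q\<close>. Every exponent in the theorem is a
  function of this number that is continuous up to the value \<open>1\<close> at \<open>q = \<infinity>\<close>, so that the finite
  and the infinite case can be treated together.
\<close>

definition conj_recip :: "ennreal \<Rightarrow> real"
  where "conj_recip q = (if q = \<infinity> then 1 else 1 - 1 / enn2real q)"

lemma enn2real_gt_1: "1 < q \<Longrightarrow> q \<noteq> \<infinity> \<Longrightarrow> 1 < enn2real q"
  by (cases q) auto

lemma conj_recip_pos: "1 < q \<Longrightarrow> 0 < conj_recip q"
  using enn2real_gt_1[of q] by (auto simp: conj_recip_def)

text \<open>
  The antiderivative of \<open>x powr (- r)\<close> vanishes at infinity because \<open>r > 1\<close>; the left half-line is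
  reflected onto the right one.
\<close>

lemma nn_integral_powr_tail:
  fixes r T :: real
  assumes r: "1 < r" and T: "0 < T"
  shows "(\<integral>\<^sup>+x. ennreal (\<bar>x\<bar> powr (- r)) * indicator {x. T < \<bar>x\<bar>} x \<partial>lebesgue)
    \<le> ennreal (2 * T powr (1 - r) / (r - 1))"
proof -
  define g where "g x = ennreal (x powr (- r)) * indicator {T..} x" for x
  have [measurable]: "g \<in> borel_measurable borel" unfolding g_def by measurable
  have g: "(\<integral>\<^sup>+x. g x \<partial>lborel) = ennreal (T powr (1 - r) / (r - 1))"
  proof -
    have "(\<integral>\<^sup>+x. g x \<partial>lborel) = ennreal (0 - T powr (1 - r) / (1 - r))"
      unfolding g_def
    proof (rule nn_integral_FTC_atLeast)
      show "((\<lambda>x. x powr (1 - r) / (1 - r)) has_real_derivative x powr (- r)) (at x)" if "T \<le> x" for x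
        using DERIV_cdivide[OF has_real_derivative_powr[of x "1 - r"], of "1 - r"] that T r by simp
      show "((\<lambda>x. x powr (1 - r) / (1 - r)) \<longlongrightarrow> 0) at_top"
        using r by (intro tendsto_divide_zero tendsto_neg_powr filterlim_ident) auto
    qed auto
    also have "0 - T powr (1 - r) / (1 - r) = T powr (1 - r) / (r - 1)"
      using r by (simp add: field_simps)
    finally show ?thesis .
  qed
  have "(\<integral>\<^sup>+x. ennreal (\<bar>x\<bar> powr (- r)) * indicator {x. T < \<bar>x\<bar>} x \<partial>lebesgue)
      \<le> (\<integral>\<^sup>+x. g x + g (0 + (-1) * x) \<partial>lborel)"
    unfolding nn_integral_completion
    using T by (intro nn_integral_mono) (auto simp: g_def indicator_def abs_if split: if_splits)
  also have "\<dots> = (\<integral>\<^sup>+x. g x \<partial>lborel) + (\<integral>\<^sup>+x. g (0 + (-1) * x) \<partial>lborel)"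
    by (rule nn_integral_add) auto
  also have "(\<integral>\<^sup>+x. g (0 + (-1) * x) \<partial>lborel) = (\<integral>\<^sup>+x. g x \<partial>lborel)"
    using nn_integral_real_affine[of g "-1" 0] by simp
  also have "(\<integral>\<^sup>+x. g x \<partial>lborel) + (\<integral>\<^sup>+x. g x \<partial>lborel) = ennreal (2 * T powr (1 - r) / (r - 1))"
    using r by (simp add: g ennreal_plus[symmetric] del: ennreal_plus)
  finally show ?thesis .
qed

lemma Lp_norm_finite_eq:
  assumes q: "1 < q" "q \<noteq> \<infinity>" and N: "Lp_norm q f = ennreal N" "0 \<le> N"
  shows "(\<integral>\<^sup>+x. ennreal (cmod (f x) powr enn2real q) \<partial>lebesgue) = ennreal (N powr enn2real q)"
proof -
  define I where "I = (\<integral>\<^sup>+x. ennreal (cmod (f x) powr enn2real q) \<partial>lebesgue)"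
  have p: "1 < enn2real q" using enn2real_gt_1 q by auto
  have *: "I epowr (1 / enn2real q) = ennreal N"
    using N q(2) by (simp add: Lp_norm_def I_def)
  then have fin: "I \<noteq> \<infinity>" by (auto simp: epowr_def)
  with * have "enn2real I powr (1 / enn2real q) = N"
    using N(2) by (simp add: epowr_def)
  then have "N powr enn2real q = enn2real I"
    using p by (auto simp: powr_powr)
  then show ?thesis using fin by (simp add: I_def[symmetric] less_top)
qed

text \<open>
  Hoelder's inequality on \<open>{-T..T}\<close> with an extra factor \<open>2\<close>. For finite \<open>q\<close> it follows from
  \<open>y \<le> c + c\<^sup>1\<^sup>-\<^sup>q * y\<^sup>q\<close>, which is clear for \<open>y \<le> c\<close>, and for \<open>y > c\<close> because \<open>y\<^sup>1\<^sup>-\<^sup>q\<close> decreases in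
  \<open>y\<close>. The level \<open>c\<close> is chosen to make the integrals of the two terms equal.
\<close>

lemma local_L1_le_Lp_norm:
  assumes q: "1 < q" and f: "f \<in> borel_measurable lebesgue"
    and N: "Lp_norm q f = ennreal N" "0 < N" and T: "0 < T"
  shows "(\<integral>\<^sup>+x. ennreal (cmod (f x)) * indicator {-T..T} x \<partial>lebesgue)
    \<le> ennreal (2 * (2 * T) powr conj_recip q * N)"
proof (cases "q = \<infinity>")
  case True
  have "(\<integral>\<^sup>+x. ennreal (cmod (f x)) * indicator {-T..T} x \<partial>lebesgue)
      \<le> (\<integral>\<^sup>+x. ennreal N * indicator {-T..T} x \<partial>lebesgue)"
  proof (rule nn_integral_mono_AE)
    show "AE x in lebesgue. ennreal (cmod (f x)) * indicator {-T..T} x \<le> ennreal N * indicator {-T..T} x"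
      using AE_le_Lp_norm_inf[of f] by eventually_elim (use N True in \<open>auto simp: indicator_def\<close>)
  qed
  also have "\<dots> = ennreal (2 * T * N)"
    using T N by (simp add: nn_integral_cmult_indicator ennreal_mult'[symmetric] mult.commute)
  also have "\<dots> \<le> ennreal (2 * (2 * T) powr conj_recip q * N)"
    using True T N by (intro ennreal_leI) (simp add: conj_recip_def)
  finally show ?thesis .
next
  case False
  define p where "p = enn2real q"
  have p: "1 < p" using enn2real_gt_1 q False by (auto simp: p_def)
  have I: "(\<integral>\<^sup>+x. ennreal (cmod (f x) powr p) \<partial>lebesgue) = ennreal (N powr p)"
    using Lp_norm_finite_eq[OF q False N(1)] N(2) by (simp add: p_def)
  define c where "c = N / (2 * T) powr (1 / p)"
  have c: "0 < c" using N T by (simp add: c_def)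
  have young: "y \<le> c + c powr (1 - p) * y powr p" if "0 \<le> y" for y
  proof (cases "y \<le> c")
    case True
    then show ?thesis by (simp add: add_increasing2)
  next
    case False
    then have "y powr (1 - p) \<le> c powr (1 - p)" using c p by (intro powr_mono2') auto
    then have "y powr (1 - p) * y powr p \<le> c powr (1 - p) * y powr p" by (rule mult_right_mono) simp
    moreover have "y powr (1 - p) * y powr p = y"
      using False c by (simp add: powr_add[symmetric])
    ultimately show ?thesis using c by linarith
  qed
  have "(\<integral>\<^sup>+x. ennreal (cmod (f x)) * indicator {-T..T} x \<partial>lebesgue)
      \<le> (\<integral>\<^sup>+x. ennreal c * indicator {-T..T} x + ennreal (c powr (1 - p)) * ennreal (cmod (f x) powr p) \<partial>lebesgue)"
  proof (intro nn_integral_mono)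
    fix x
    have "ennreal (cmod (f x)) \<le> ennreal c + ennreal (c powr (1 - p)) * ennreal (cmod (f x) powr p)"
      using ennreal_leI[OF young[of "cmod (f x)"]] c by (simp add: ennreal_mult' ennreal_plus)
    then show "ennreal (cmod (f x)) * indicator {-T..T} x
        \<le> ennreal c * indicator {-T..T} x + ennreal (c powr (1 - p)) * ennreal (cmod (f x) powr p)"
      by (auto simp: indicator_def)
  qed
  also have "\<dots> = (\<integral>\<^sup>+x. ennreal c * indicator {-T..T} x \<partial>lebesgue)
      + (\<integral>\<^sup>+x. ennreal (c powr (1 - p)) * ennreal (cmod (f x) powr p) \<partial>lebesgue)"
    using f by (intro nn_integral_add borel_measurable_times_ennreal borel_measurable_indicator) auto
  also have "\<dots> = ennreal (c * (2 * T)) + ennreal (c powr (1 - p)) * ennreal (N powr p)"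
    using f T c by (subst nn_integral_cmult)
      (auto simp: nn_integral_cmult_indicator ennreal_mult'[symmetric] I)
  also have "\<dots> = ennreal (c * (2 * T) + c powr (1 - p) * N powr p)"
    using c T by (simp add: ennreal_mult'[symmetric] ennreal_plus[symmetric] del: ennreal_plus)
  also have "c * (2 * T) + c powr (1 - p) * N powr p = 2 * (2 * T) powr conj_recip q * N"
  proof -
    have \<alpha>: "conj_recip q = 1 - 1 / p" using False by (simp add: conj_recip_def p_def)
    have "c * (2 * T) = (2 * T) powr conj_recip q * N"
      using T by (simp add: c_def \<alpha> powr_diff)
    moreover have "c powr (1 - p) * N powr p = (2 * T) powr conj_recip q * N"
    proof -
      have "c powr (1 - p) = N powr (1 - p) * (2 * T) powr (- (1 / p * (1 - p)))"
        using N T by (simp add: c_def powr_divide powr_powr powr_minus_divide)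
      also have "- (1 / p * (1 - p)) = conj_recip q" using p by (simp add: \<alpha> field_simps)
      finally have "c powr (1 - p) * N powr p = (2 * T) powr conj_recip q * (N powr (1 - p) * N powr p)"
        by simp
      also have "N powr (1 - p) * N powr p = N" using N by (simp add: powr_add[symmetric])
      finally show ?thesis .
    qed
    ultimately show ?thesis by simp
  qed
  finally show ?thesis .
qed

text \<open>
  The Cauchy--Schwarz inequality for \<open>\<bar>x\<bar> powr (- r / 2)\<close> and \<open>\<bar>x\<bar> powr (r / 2) * cmod (f x)\<close>, with
  the geometric mean replaced by an arithmetic mean weighted by a free parameter \<open>l\<close>. Keeping \<open>l\<close>
  free avoids dividing by the moment, which might vanish.
\<close>

lemma tail_L1_le_moment:
  assumes r: "1 < r" and f: "f \<in> borel_measurable lebesgue"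
    and m: "moment r f = ennreal m" "0 \<le> m" and T: "0 < T" and l: "0 < l"
  shows "(\<integral>\<^sup>+x. ennreal (cmod (f x)) * indicator {x. T < \<bar>x\<bar>} x \<partial>lebesgue)
    \<le> ennreal (l * (2 * T powr (1 - r) / (r - 1)) + m / l)"
proof -
  define tail :: "real \<Rightarrow> ennreal" where "tail = indicator {x. T < \<bar>x\<bar>}"
  have [measurable]: "f \<in> borel_measurable lebesgue" by (rule f)
  have tail[measurable]: "tail \<in> borel_measurable lebesgue"
    unfolding tail_def by (intro measurable_completion) measurable
  have abs[measurable]: "(\<lambda>x::real. \<bar>x\<bar> powr a) \<in> borel_measurable lebesgue" for a
    by (intro measurable_completion) measurable
  have am_gm: "y \<le> l * a + 1 / l * (y\<^sup>2 / a)" if "0 < a" "0 \<le> y" for y a :: real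
  proof (cases "y \<le> l * a")
    case True
    then show ?thesis using that l by (intro add_increasing2) auto
  next
    case False
    then have "y * (l * a) \<le> y * y" using that by (intro mult_left_mono) auto
    then have "y \<le> 1 / l * (y\<^sup>2 / a)" using that l by (simp add: field_simps power2_eq_square)
    then show ?thesis using that l by (intro add_increasing) auto
  qed
  have "(\<integral>\<^sup>+x. ennreal (cmod (f x)) * tail x \<partial>lebesgue)
      \<le> (\<integral>\<^sup>+x. ennreal l * (ennreal (\<bar>x\<bar> powr (- r)) * tail x)
          + ennreal (1 / l) * ennreal (\<bar>x\<bar> powr r * (cmod (f x))\<^sup>2) \<partial>lebesgue)"
  proof (intro nn_integral_mono)
    fix x :: real
    show "ennreal (cmod (f x)) * tail x \<le> ennreal l * (ennreal (\<bar>x\<bar> powr (- r)) * tail x)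
        + ennreal (1 / l) * ennreal (\<bar>x\<bar> powr r * (cmod (f x))\<^sup>2)"
    proof (cases "T < \<bar>x\<bar>")
      case True
      then have x: "0 < \<bar>x\<bar>" using T by simp
      then have "cmod (f x) \<le> l * \<bar>x\<bar> powr (- r) + 1 / l * (\<bar>x\<bar> powr r * (cmod (f x))\<^sup>2)"
        using am_gm[of "\<bar>x\<bar> powr (- r)" "cmod (f x)"] by (simp add: powr_minus_divide mult.commute)
      from ennreal_leI[OF this] show ?thesis
        using l True by (simp add: tail_def ennreal_mult'[symmetric])
    qed (simp add: tail_def)
  qed
  also have "\<dots> = ennreal l * (\<integral>\<^sup>+x. ennreal (\<bar>x\<bar> powr (- r)) * tail x \<partial>lebesgue)
      + ennreal (1 / l) * moment r f"
    unfolding moment_def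
    by (subst nn_integral_add, measurable, subst nn_integral_cmult, measurable,
        subst nn_integral_cmult, measurable)
  also have "\<dots> \<le> ennreal l * ennreal (2 * T powr (1 - r) / (r - 1)) + ennreal (1 / l) * ennreal m"
    unfolding m(1) tail_def by (intro add_right_mono mult_left_mono nn_integral_powr_tail r T) simp
  also have "\<dots> = ennreal (l * (2 * T powr (1 - r) / (r - 1)) + m / l)"
    using l m r by (simp add: ennreal_mult'[symmetric] ennreal_plus[symmetric] del: ennreal_plus)
  finally show ?thesis by (simp add: tail_def)
qed

lemma L1_le_Lp_norm_plus_moment:
  assumes "1 < r" "1 < q" and f: "integrable lebesgue f"
    and N: "Lp_norm q f = ennreal N" "0 < N" and m: "moment r f = ennreal m" "0 \<le> m"
    and T: "0 < T" and l: "0 < l"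
  shows "(\<integral>x. cmod (f x) \<partial>lebesgue)
    \<le> 2 * (2 * T) powr conj_recip q * N + l * (2 * T powr (1 - r) / (r - 1)) + m / l"
proof -
  have [measurable]: "f \<in> borel_measurable lebesgue" using f by auto
  have [measurable]: "{x::real. T < \<bar>x\<bar>} \<in> sets lebesgue"
    by (intro sets_completionI_sets) simp
  have "ennreal (\<integral>x. cmod (f x) \<partial>lebesgue) = (\<integral>\<^sup>+x. ennreal (cmod (f x)) \<partial>lebesgue)"
    using f by (simp add: nn_integral_eq_integral)
  also have "\<dots> = (\<integral>\<^sup>+x. ennreal (cmod (f x)) * indicator {-T..T} x
      + ennreal (cmod (f x)) * indicator {x. T < \<bar>x\<bar>} x \<partial>lebesgue)"
    by (intro nn_integral_cong) (auto simp: indicator_def)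
  also have "\<dots> = (\<integral>\<^sup>+x. ennreal (cmod (f x)) * indicator {-T..T} x \<partial>lebesgue)
      + (\<integral>\<^sup>+x. ennreal (cmod (f x)) * indicator {x. T < \<bar>x\<bar>} x \<partial>lebesgue)"
    by (intro nn_integral_add borel_measurable_times_ennreal borel_measurable_indicator) auto
  also have "\<dots> \<le> ennreal (2 * (2 * T) powr conj_recip q * N)
      + ennreal (l * (2 * T powr (1 - r) / (r - 1)) + m / l)"
    using assms by (intro add_mono local_L1_le_Lp_norm tail_L1_le_moment) auto
  also have "\<dots> = ennreal (2 * (2 * T) powr conj_recip q * N
      + l * (2 * T powr (1 - r) / (r - 1)) + m / l)"
    using assms by (simp add: ennreal_plus[symmetric] add.assoc del: ennreal_plus)
  finally show ?thesis
    using assms by (subst (asm) ennreal_le_iff) (auto intro!: add_nonneg_nonneg)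
qed

text \<open>
  For finite \<open>q\<close> this integrates the pointwise bound of \<open>cmod (f x) powr q\<close> by
  \<open>X powr (q - 1) * cmod (f x)\<close>.
\<close>

lemma Lp_norm_interpolation:
  assumes q: "1 < q" and f: "integrable lebesgue f"
    and L: "(\<integral>x. cmod (f x) \<partial>lebesgue) = L" "0 < L"
    and X: "AE x in lebesgue. cmod (f x) \<le> X" "0 < X"
  shows "Lp_norm q f \<le> ennreal (L powr (1 - conj_recip q) * X powr conj_recip q)"
proof (cases "q = \<infinity>")
  case True
  then show ?thesis using Lp_norm_inf_le[OF _ X(1)] f L X by (simp add: conj_recip_def)
next
  case False
  define p where "p = enn2real q"
  have p: "1 < p" using enn2real_gt_1 q False by (auto simp: p_def)
  define I where "I = (\<integral>\<^sup>+x. ennreal (cmod (f x) powr p) \<partial>lebesgue)"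
  have "I \<le> (\<integral>\<^sup>+x. ennreal (X powr (p - 1)) * ennreal (cmod (f x)) \<partial>lebesgue)"
    unfolding I_def
  proof (rule nn_integral_mono_AE, use X(1) in eventually_elim)
    fix x assume le: "cmod (f x) \<le> X"
    have "cmod (f x) powr p = cmod (f x) powr (p - 1) * cmod (f x)"
      using p by (cases "f x = 0") (simp_all add: powr_diff)
    also have "\<dots> \<le> X powr (p - 1) * cmod (f x)"
      using le p by (intro mult_right_mono powr_mono2) auto
    finally show "ennreal (cmod (f x) powr p) \<le> ennreal (X powr (p - 1)) * ennreal (cmod (f x))"
      by (simp add: ennreal_mult'[symmetric] ennreal_leI)
  qed
  also have "\<dots> = ennreal (X powr (p - 1)) * (\<integral>\<^sup>+x. ennreal (cmod (f x)) \<partial>lebesgue)"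
    using f by (intro nn_integral_cmult) auto
  also have "\<dots> = ennreal (X powr (p - 1) * L)"
    using f L by (simp add: nn_integral_eq_integral ennreal_mult')
  finally have I: "I \<le> ennreal (X powr (p - 1) * L)" .
  then have I_fin: "I \<noteq> \<infinity>" by (auto simp: top_unique)
  have "enn2real I \<le> X powr (p - 1) * L"
    using I L by (intro enn2real_leI) auto
  then have "enn2real I powr (1 / p) \<le> (X powr (p - 1) * L) powr (1 / p)"
    using p by (intro powr_mono2) auto
  also have "\<dots> = L powr (1 / p) * X powr ((p - 1) * (1 / p))"
    using L X by (simp add: powr_mult powr_powr)
  also have "(p - 1) * (1 / p) = conj_recip q"
    using False p by (simp add: conj_recip_def p_def field_simps)
  also have p_eq: "1 / p = 1 - conj_recip q"
    using False by (simp add: conj_recip_def p_def)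
  finally have "enn2real I powr (1 / p) \<le> L powr (1 - conj_recip q) * X powr conj_recip q"
    by (simp add: p_eq)
  then show ?thesis
    using False I_fin by (simp add: Lp_norm_def p_def[symmetric] I_def[symmetric] epowr_def ennreal_leI)
qed

lemma Lp_norm_eq_0_iff:
  assumes q: "1 < q" and f: "f \<in> borel_measurable lebesgue"
  shows "Lp_norm q f = 0 \<longleftrightarrow> (AE x in lebesgue. f x = 0)"
proof (cases "q = \<infinity>")
  case True
  show ?thesis
  proof
    assume "Lp_norm q f = 0"
    with AE_le_Lp_norm_inf[of f] show "AE x in lebesgue. f x = 0"
      unfolding True by (auto elim: eventually_mono)
  next
    assume "AE x in lebesgue. f x = 0"
    then have "AE x in lebesgue. cmod (f x) \<le> 0" by simp
    from Lp_norm_inf_le[OF f this] show "Lp_norm q f = 0" by (simp add: True)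
  qed
next
  case False
  define I where "I = (\<integral>\<^sup>+x. ennreal (cmod (f x) powr enn2real q) \<partial>lebesgue)"
  have "Lp_norm q f = 0 \<longleftrightarrow> I = 0"
    using False enn2real_gt_1[OF q] by (cases I) (auto simp: Lp_norm_def I_def[symmetric] epowr_def)
  also have "\<dots> \<longleftrightarrow> (AE x in lebesgue. f x = 0)"
    unfolding I_def using f by (subst nn_integral_0_iff_AE) auto
  finally show ?thesis .
qed

lemma moment_eq_0_iff:
  assumes f: "f \<in> borel_measurable lebesgue"
  shows "moment r f = 0 \<longleftrightarrow> (AE x in lebesgue. f x = 0)"
proof -
  have [measurable]: "(\<lambda>x::real. \<bar>x\<bar> powr r) \<in> borel_measurable lebesgue"
    by (intro measurable_completion) measurable
  have [measurable]: "f \<in> borel_measurable lebesgue" by (rule f)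
  have nz: "AE x::real in lebesgue. x \<noteq> 0"
    by (rule AE_completion) (rule AE_lborel_singleton)
  have "moment r f = 0 \<longleftrightarrow> (AE x in lebesgue. ennreal (\<bar>x\<bar> powr r * (cmod (f x))\<^sup>2) = 0)"
    unfolding moment_def by (rule nn_integral_0_iff_AE) measurable
  also have "\<dots> \<longleftrightarrow> (AE x in lebesgue. f x = 0)"
    using nz by (intro eventually_subst) (auto elim!: eventually_mono simp: ennreal_eq_0_iff mult_le_0_iff)
  finally show ?thesis .
qed

section \<open>The exponents as functions of \<open>1 - 1/q\<close>\<close>

text \<open>
  Since \<open>1 - 1/p\<close> tends to \<open>1\<close> as \<open>p\<close> grows, continuity of \<open>E\<close> at \<open>1\<close> identifies the limit that
  defines the exponent at \<open>q = \<infinity>\<close>.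
\<close>

lemma exponent_at_eq:
  assumes q: "1 < q" and e: "\<And>p. 1 < p \<Longrightarrow> e p = E (1 - 1 / p)" and E: "isCont E 1"
  shows "exponent_at q e = E (conj_recip q)"
proof (cases "q = \<infinity>")
  case True
  have "((\<lambda>p::real. 1 / p) \<longlongrightarrow> 0) at_top"
    by (intro tendsto_divide_0[OF tendsto_const] filterlim_at_top_imp_at_infinity filterlim_ident)
  then have "((\<lambda>p::real. 1 - 1 / p) \<longlongrightarrow> 1 - 0) at_top"
    by (intro tendsto_diff tendsto_const)
  then have "((\<lambda>p. E (1 - 1 / p)) \<longlongrightarrow> E 1) at_top"
    by (intro isCont_tendsto_compose[OF E]) simp
  then have "(e \<longlongrightarrow> E 1) at_top"
    by (rule Lim_transform_eventually) (use e in \<open>auto intro!: eventually_mono[OF eventually_gt_at_top[of 1]]\<close>)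
  then show ?thesis
    using True by (simp add: exponent_at_def conj_recip_def tendsto_Lim)
next
  case False
  then show ?thesis
    using e[OF enn2real_gt_1[OF q False]] by (simp add: exponent_at_def conj_recip_def)
qed

lemma exponent_k: "1 < q \<Longrightarrow> exponent_at q (\<lambda>q. 1 - 1 / q) = conj_recip q"
  by (rule exponent_at_eq) auto

context
  fixes q :: ennreal and r :: real
  assumes q: "1 < q" and r: "1 < r"
begin

lemma denominator_eq: "p * r + p - 2 = p * (r - 1 + 2 * (1 - 1 / p))" if "1 < p" for p :: real
  using that by (simp add: field_simps)

lemma exponent_moment:
  "exponent_at q (\<lambda>q. (q - 1) / (q * r + q - 2)) = conj_recip q / (r - 1 + 2 * conj_recip q)"
proof (rule exponent_at_eq[OF q])
  fix p :: real assume p: "1 < p"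
  then have "p - 1 = p * (1 - 1 / p)" by (simp add: field_simps)
  then show "(p - 1) / (p * r + p - 2) = (1 - 1 / p) / (r - 1 + 2 * (1 - 1 / p))"
    using p by (simp only: denominator_eq[OF p] mult_divide_mult_cancel_left)
qed (use r in \<open>auto intro!: continuous_intros\<close>)

lemma exponent_norm:
  "exponent_at q (\<lambda>q. (2 * q - 2) / (q * r + q - 2)) = 2 * (conj_recip q / (r - 1 + 2 * conj_recip q))"
proof (rule exponent_at_eq[OF q])
  fix p :: real assume p: "1 < p"
  then have "2 * p - 2 = p * (2 * (1 - 1 / p))" by (simp add: field_simps)
  then show "(2 * p - 2) / (p * r + p - 2) = 2 * ((1 - 1 / p) / (r - 1 + 2 * (1 - 1 / p)))"
    using p by (simp only: denominator_eq[OF p] mult_divide_mult_cancel_left times_divide_eq_right)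
qed (use r in \<open>auto intro!: continuous_intros\<close>)

lemma exponent_const:
  "exponent_at q (\<lambda>q. 2 * (q * r + q - 2) / (q - 1)) = 2 / (conj_recip q / (r - 1 + 2 * conj_recip q))"
proof (rule exponent_at_eq[OF q])
  fix p :: real assume p: "1 < p"
  then have "p - 1 = p * (1 - 1 / p)" by (simp add: field_simps)
  then show "2 * (p * r + p - 2) / (p - 1) = 2 / ((1 - 1 / p) / (r - 1 + 2 * (1 - 1 / p)))"
    using p by (simp only: denominator_eq[OF p] mult.left_commute[of 2] mult_divide_mult_cancel_left divide_divide_eq_right)
qed (use r in \<open>auto intro!: continuous_intros\<close>)

lemma exponent_k_symmetric: "exponent_at q (\<lambda>q. (q * r + q - 2) / q) = r - 1 + 2 * conj_recip q"
  by (rule exponent_at_eq[OF q]) (auto simp: denominator_eq intro!: continuous_intros)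

end

section \<open>The lower bound for one moment\<close>

text \<open>
  The constant that results from the choices of \<open>T\<close> and \<open>l\<close> in the next lemma; \<open>a\<close> stands for
  \<open>1 - 1/q\<close>.
\<close>

definition moment_const :: "real \<Rightarrow> real \<Rightarrow> real"
  where "moment_const r a =
    ((r - 1) * 2 powr (1 - r) * 4 powr (- ((r - 1) / a)) / 32) powr (a / (r - 1 + 2 * a))"

lemma moment_const_pos: "1 < r \<Longrightarrow> 0 < moment_const r a"
  by (simp add: moment_const_def)

text \<open>
  The radius \<open>T\<close> is chosen so that the first of the three terms equals \<open>L / 2\<close>, and then \<open>l\<close> so that
  the second one equals \<open>L / 4\<close>. The third term is left to account for the remaining quarter, which
  gives \<open>m \<ge> \<kappa> * N\<^sup>2 * (L / N) powr (2 + (r - 1) / a)\<close>, and \<open>\<theta>\<close> is the reciprocal of the last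
  exponent.
\<close>

lemma optimize_split_radius:
  fixes L N m r a :: real
  assumes r: "1 < r" and a: "0 < a" and L: "0 < L" and N: "0 < N" and m: "0 \<le> m"
    and split: "\<And>T l. 0 < T \<Longrightarrow> 0 < l \<Longrightarrow>
      L \<le> 2 * (2 * T) powr a * N + l * (2 * T powr (1 - r) / (r - 1)) + m / l"
  defines "\<theta> \<equiv> a / (r - 1 + 2 * a)"
  shows "moment_const r a * L * N powr (2 * \<theta>) \<le> m powr \<theta> * N"
proof -
  define T where "T = (L / (4 * N)) powr (1 / a) / 2"
  define l where "l = L * T powr (r - 1) * (r - 1) / 8"
  have T: "0 < T" using L N by (simp add: T_def)
  have l: "0 < l" using L T r by (simp add: l_def)
  have \<theta>: "0 < \<theta>" using r a by (simp add: \<theta>_def)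
  have inner: "2 * (2 * T) powr a * N = L / 2"
    using L N a by (simp add: T_def powr_powr)
  have outer: "l * (2 * T powr (1 - r) / (r - 1)) = L / 4"
  proof -
    have "T powr (r - 1) * T powr (1 - r) = 1" using T by (simp add: powr_add[symmetric])
    then show ?thesis using r by (simp add: l_def field_simps)
  qed
  have "L / 4 \<le> m / l" using split[OF T l] unfolding inner outer by linarith
  then have "L * l / 4 \<le> m" using l by (simp add: field_simps)
  define \<kappa> where "\<kappa> = (r - 1) * 2 powr (1 - r) * 4 powr (- ((r - 1) / a)) / 32"
  have T_powr: "T powr (r - 1) = 2 powr (1 - r) * 4 powr (- ((r - 1) / a)) * (L / N) powr ((r - 1) / a)"
  proof -
    define x where "x = L / N"
    define y where "y = (r - 1) / a"
    have T_eq: "T = (x / 4) powr (1 / a) / 2" by (simp add: T_def x_def mult.commute)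
    have "T powr (r - 1) = (x / 4) powr y / 2 powr (r - 1)"
      unfolding T_eq by (simp add: y_def powr_divide[of "(x / 4) powr (1 / a)"] powr_powr)
    also have "(x / 4) powr y = x powr y / 4 powr y"
      by (rule powr_divide)
    finally show ?thesis
      using powr_minus_divide[of 2 "r - 1"] powr_minus_divide[of 4 y] by (simp add: x_def y_def)
  qed
  have "\<kappa> * (L\<^sup>2 * (L / N) powr ((r - 1) / a)) = L * l / 4"
    unfolding l_def T_powr \<kappa>_def by (simp add: power2_eq_square)
  also have "\<dots> \<le> m" by fact
  finally have "\<kappa> * (L\<^sup>2 * (L / N) powr ((r - 1) / a)) \<le> m" .
  also have "L\<^sup>2 * (L / N) powr ((r - 1) / a) = N\<^sup>2 * (L / N) powr (1 / \<theta>)"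
  proof -
    have "1 / \<theta> = 2 + (r - 1) / a" using a by (simp add: \<theta>_def field_simps)
    then have "(L / N) powr (1 / \<theta>) = (L / N)\<^sup>2 * (L / N) powr ((r - 1) / a)"
      using L N by (simp add: powr_add powr_numeral)
    then show ?thesis using N by (simp add: power_divide)
  qed
  finally have "(\<kappa> * (N\<^sup>2 * (L / N) powr (1 / \<theta>))) powr \<theta> \<le> m powr \<theta>"
    using r \<theta> by (intro powr_mono2) (auto simp: \<kappa>_def)
  moreover have "(\<kappa> * (N\<^sup>2 * (L / N) powr (1 / \<theta>))) powr \<theta> = \<kappa> powr \<theta> * (N powr (2 * \<theta>) * (L / N))"
  proof -
    have "N\<^sup>2 powr \<theta> = (N powr 2) powr \<theta>" using N by (simp only: powr_numeral)
    then have "N\<^sup>2 powr \<theta> = N powr (2 * \<theta>)" by (simp only: powr_powr)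
    moreover have "((L / N) powr (1 / \<theta>)) powr \<theta> = L / N" using L N \<theta> by (simp add: powr_powr)
    ultimately show ?thesis by (simp only: powr_mult)
  qed
  moreover have "\<kappa> powr \<theta> = moment_const r a" by (simp add: \<kappa>_def \<theta>_def moment_const_def)
  ultimately have "moment_const r a * (N powr (2 * \<theta>) * (L / N)) \<le> m powr \<theta>" by simp
  from mult_right_mono[OF this, of N] show ?thesis using N by (simp add: ac_simps)
qed

text \<open>
  In the form \<open>C * (L / N) \<le> (m / N\<^sup>2) powr \<theta>\<close>, with \<open>L\<close> the \<open>L\<^sup>1\<close> norm, this says that a moment small
  against \<open>N\<^sup>2\<close> forces the ratio of the \<open>L\<^sup>1\<close> norm to the \<open>L\<^sup>q\<close> norm to be small. Both sides scale
  alike under dilations of \<open>f\<close>.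
\<close>

lemma moment_lower_bound:
  assumes r: "1 < r" and q: "1 < q" and f: "integrable lebesgue f"
    and N: "Lp_norm q f = ennreal N" "0 < N" and m: "moment r f = ennreal m" "0 \<le> m"
    and L: "0 < (\<integral>x. cmod (f x) \<partial>lebesgue)"
  defines "\<theta> \<equiv> conj_recip q / (r - 1 + 2 * conj_recip q)"
  shows "moment_const r (conj_recip q) * (\<integral>x. cmod (f x) \<partial>lebesgue) * N powr (2 * \<theta>) \<le> m powr \<theta> * N"
  unfolding \<theta>_def
  using optimize_split_radius[OF r conj_recip_pos[OF q] L N(2) m(2)]
    L1_le_Lp_norm_plus_moment[OF r q f N m] by blast

section \<open>The uncertainty principle\<close>

text \<open>
  Here \<open>L\<close>, \<open>N\<close> are the \<open>L\<^sup>1\<close> and \<open>L\<^sup>q\<close> norms of \<open>f\<close>, and \<open>L'\<close>, \<open>N'\<close> those of \<open>A f\<close>; \<open>M\<close>, \<open>M'\<close> are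
  powers of the moments, and \<open>R\<close>, \<open>R'\<close> powers of the \<open>L\<^sup>q\<close> norms. When the two
  interpolation bounds are multiplied, the powers of \<open>L\<close> and \<open>L'\<close> become \<open>L * L'\<close>, so that
  \<open>k powr a \<le> (L / N) * (L' / N')\<close>: the norm ratios cannot both be small.
\<close>

lemma combine_moment_bounds:
  fixes a :: real
  assumes k: "0 < k" and pos: "0 < L" "0 < L'" "0 < N" "0 < N'" "0 \<le> c" "0 \<le> c'"
    and N: "N \<le> L powr (1 - a) * (L' / k) powr a" and N': "N' \<le> L' powr (1 - a) * L powr a"
    and m: "c * L * R \<le> M * N" "0 \<le> R" and m': "c' * L' * R' \<le> M' * N'" "0 \<le> R'"
    and M: "0 \<le> M" "0 \<le> M'"
  shows "c * c' * k powr a * R * R' \<le> M * M'"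
proof -
  have "N * N' \<le> (L powr (1 - a) * (L' / k) powr a) * (L' powr (1 - a) * L powr a)"
    using N N' pos by (intro mult_mono) auto
  also have "\<dots> = (L powr (1 - a) * L powr a) * (L' powr (1 - a) * L' powr a) / k powr a"
    using pos k by (simp add: powr_divide)
  also have "\<dots> = L * L' / k powr a"
    using pos by (simp add: powr_add[symmetric])
  finally have NN: "k powr a * (N * N') \<le> L * L'"
    using k by (simp add: field_simps)
  have "c * c' * k powr a * R * R' * (N * N') = (c * c' * R * R') * (k powr a * (N * N'))"
    by (simp add: ac_simps)
  also have "\<dots> \<le> (c * c' * R * R') * (L * L')"
    using NN pos m m' by (intro mult_left_mono) auto
  also have "\<dots> = (c * L * R) * (c' * L' * R')" by (simp add: ac_simps)
  also have "\<dots> \<le> (M * N) * (M' * N')"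
    by (rule mult_mono[OF m(1) m'(1)]) (use pos M m' in \<open>auto\<close>)
  also have "\<dots> = M * M' * (N * N')" by (simp add: ac_simps)
  finally show ?thesis
    using pos by (simp add: mult_le_cancel_right)
qed

lemma epowr_ennreal: "0 \<le> x \<Longrightarrow> ennreal x epowr a = ennreal (x powr a)"
  by (simp add: epowr_def)

lemma top_epowr: "top epowr a = top"
  by (simp add: epowr_def)

lemma epowr_eq_0_iff: "x epowr a = 0 \<longleftrightarrow> x = 0"
  by (cases x) (auto simp: epowr_def)

text \<open>
  The second estimate comes from \<open>k * \<parallel>f\<parallel>\<^sub>\<infinity> \<le> \<parallel>A\<^sup>* A f\<parallel>\<^sub>\<infinity> \<le> \<parallel>A f\<parallel>\<^sub>1\<close>. Together the two estimates are the
  primary uncertainty principle \<open>\<parallel>f\<parallel>\<^sub>1 * \<parallel>A f\<parallel>\<^sub>1 \<ge> k * \<parallel>f\<parallel>\<^sub>\<infinity> * \<parallel>A f\<parallel>\<^sub>\<infinity>\<close>.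
\<close>

lemma Hadamard_op_bounds:
  assumes A: "Hadamard_op k A" and k: "0 < k" and f: "doubly_L1 A f"
  shows "AE x in lebesgue. cmod (A f x) \<le> (\<integral>x. cmod (f x) \<partial>lebesgue)"
    and "AE x in lebesgue. cmod (f x) \<le> (\<integral>x. cmod (A f x) \<partial>lebesgue) / k"
proof -
  interpret L1_Linf_contraction A
    using A by unfold_locales (auto simp: Hadamard_op_def)
  have f1: "integrable lebesgue f" and f2: "integrable lebesgue (A f)"
    using f by (auto simp: doubly_L1_def L1_space_def)
  show "AE x in lebesgue. cmod (A f x) \<le> (\<integral>x. cmod (f x) \<partial>lebesgue)"
    by (rule A_bound[OF f1])
  define L where "L = (\<integral>x. cmod (A f x) \<partial>lebesgue)"
  have L: "0 \<le> L" by (simp add: L_def)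
  have "ennreal k * Lp_norm \<infinity> f \<le> Lp_norm \<infinity> (adjoint_L1 A (A f))"
    using A f by (auto simp: Hadamard_op_def)
  also have "\<dots> \<le> ennreal L"
    using adjoint_bound[OF f2] f2 by (simp add: Lp_norm_1 L_def)
  finally have le: "ennreal k * Lp_norm \<infinity> f \<le> ennreal L" .
  show "AE x in lebesgue. cmod (f x) \<le> L / k"
    using AE_le_Lp_norm_inf[of f]
  proof eventually_elim
    fix x assume "ennreal (cmod (f x)) \<le> Lp_norm \<infinity> f"
    then have "ennreal k * ennreal (cmod (f x)) \<le> ennreal k * Lp_norm \<infinity> f"
      by (rule mult_left_mono) simp
    also note le
    finally have "ennreal (k * cmod (f x)) \<le> ennreal L"
      using k by (simp add: ennreal_mult)
    then show "cmod (f x) \<le> L / k"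
      using L k by (simp add: field_simps)
  qed
qed

lemma L1_norm_pos:
  assumes f: "integrable lebesgue f" and nz: "\<not> (AE x in lebesgue. f x = 0)"
  shows "0 < (\<integral>x. cmod (f x) \<partial>lebesgue)"
proof -
  have "(\<integral>x. cmod (f x) \<partial>lebesgue) \<noteq> 0"
    using nz f by (subst integral_nonneg_eq_0_iff_AE) auto
  then show ?thesis by (simp add: less_le)
qed

lemma Lp_norm_real:
  assumes q: "1 < q" and f: "integrable lebesgue f" and nz: "\<not> (AE x in lebesgue. f x = 0)"
    and X: "AE x in lebesgue. cmod (f x) \<le> X" "0 < X"
  obtains N where "Lp_norm q f = ennreal N" "0 < N"
    "N \<le> (\<integral>x. cmod (f x) \<partial>lebesgue) powr (1 - conj_recip q) * X powr conj_recip q"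
proof -
  have le: "Lp_norm q f \<le> ennreal ((\<integral>x. cmod (f x) \<partial>lebesgue) powr (1 - conj_recip q) * X powr conj_recip q)"
    by (rule Lp_norm_interpolation[OF q f refl L1_norm_pos[OF f nz] X])
  have "Lp_norm q f \<noteq> 0" using Lp_norm_eq_0_iff[OF q] f nz by auto
  then show ?thesis
    using le by (cases "Lp_norm q f") (auto intro!: that simp: top_unique)
qed

theorem theorem4p14:
  shows "\<exists>C :: real \<Rightarrow> ennreal \<Rightarrow> real.
    (\<forall>r q. 1 < r \<longrightarrow> 1 < q \<longrightarrow> 0 < C r q) \<and>
    (\<forall>(r::real) (s::real) (q::ennreal) (k::real)
      (A :: (real \<Rightarrow> complex) \<Rightarrow> real \<Rightarrow> complex) (f :: real \<Rightarrow> complex).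
      1 < r \<longrightarrow> 1 < s \<longrightarrow> 1 < q \<longrightarrow> 0 < k \<longrightarrow> Hadamard_op k A \<longrightarrow> doubly_L1 A f \<longrightarrow>
        moment r f epowr exponent_at q (\<lambda>q. (q - 1) / (q * r + q - 2)) *
        moment s (A f) epowr exponent_at q (\<lambda>q. (q - 1) / (q * s + q - 2))
          \<ge> ennreal (C r q * C s q * k powr exponent_at q (\<lambda>q. 1 - 1 / q)) *
            Lp_norm q f epowr exponent_at q (\<lambda>q. (2 * q - 2) / (q * r + q - 2)) *
            Lp_norm q (A f) epowr exponent_at q (\<lambda>q. (2 * q - 2) / (q * s + q - 2)) \<and>
        (s = r \<longrightarrow>
          moment r f * moment r (A f)
            \<ge> ennreal (C r q powr exponent_at q (\<lambda>q. 2 * (q * r + q - 2) / (q - 1)) *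
                        k powr exponent_at q (\<lambda>q. (q * r + q - 2) / q)) *
              (Lp_norm q f)\<^sup>2 * (Lp_norm q (A f))\<^sup>2))"
proof (rule exI[of _ "\<lambda>r q. moment_const r (conj_recip q)"], intro conjI allI impI)
  show "0 < moment_const r (conj_recip q)" if "1 < r" for r q
    using that by (rule moment_const_pos)
next
  fix r s k :: real and q :: ennreal and A f
  assume r: "1 < r" and s: "1 < s" and q: "1 < q" and k: "0 < k"
    and A: "Hadamard_op k A" and f: "doubly_L1 A f"
  define a where "a = conj_recip q"
  have a: "0 < a" using conj_recip_pos[OF q] by (simp add: a_def)
  define \<theta> where "\<theta> t = a / (t - 1 + 2 * a)" for t :: real
  have \<theta>: "0 < \<theta> t" if "1 < t" for t using that a by (simp add: \<theta>_def)
  define C where "C t = moment_const t a" for t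
  have C: "0 < C t" if "1 < t" for t using that by (simp add: C_def moment_const_pos)
  define g where "g = A f"
  have f1: "integrable lebesgue f" and g1: "integrable lebesgue g"
    using f by (auto simp: doubly_L1_def L1_space_def g_def)
  have [measurable]: "f \<in> borel_measurable lebesgue" "g \<in> borel_measurable lebesgue"
    using f1 g1 by auto
  note bounds = Hadamard_op_bounds[OF A k f, folded g_def]
  have "ennreal (C r * C s * k powr a) * Lp_norm q f epowr (2 * \<theta> r) * Lp_norm q g epowr (2 * \<theta> s)
        \<le> moment r f epowr \<theta> r * moment s g epowr \<theta> s \<and>
      (s = r \<longrightarrow> ennreal (C r powr (2 / \<theta> r) * k powr (r - 1 + 2 * a)) * (Lp_norm q f)\<^sup>2 * (Lp_norm q g)\<^sup>2
        \<le> moment r f * moment r g)"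
  proof (cases "AE x in lebesgue. f x = 0")
    case True
    then have "Lp_norm q f = 0" using Lp_norm_eq_0_iff[OF q] by simp
    then show ?thesis by (simp add: epowr_eq_0_iff[THEN iffD2])
  next
    case f_nz: False
    define L where "L = (\<integral>x. cmod (f x) \<partial>lebesgue)"
    define L' where "L' = (\<integral>x. cmod (g x) \<partial>lebesgue)"
    \<comment> \<open>The bound of \<open>f\<close> by the \<open>L\<^sup>1\<close> norm of \<open>A f\<close> makes the kernel of \<open>A\<close> trivial.\<close>
    have g_nz: "\<not> (AE x in lebesgue. g x = 0)"
    proof
      assume "AE x in lebesgue. g x = 0"
      then have "L' = 0" unfolding L'_def by (subst integral_cong_AE[of _ _ "\<lambda>x. 0"]) auto
      with bounds(2) have "AE x in lebesgue. f x = 0" by (simp add: L'_def)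
      with f_nz show False ..
    qed
    have L: "0 < L" and L': "0 < L'"
      unfolding L_def L'_def using L1_norm_pos f1 g1 f_nz g_nz by auto
    obtain N where N: "Lp_norm q f = ennreal N" "0 < N" "N \<le> L powr (1 - a) * (L' / k) powr a"
      using Lp_norm_real[OF q f1 f_nz bounds(2)] L' k unfolding L_def L'_def a_def by auto
    obtain N' where N': "Lp_norm q g = ennreal N'" "0 < N'" "N' \<le> L' powr (1 - a) * L powr a"
      using Lp_norm_real[OF q g1 g_nz bounds(1)] L unfolding L_def L'_def a_def by auto
    have m_nz: "moment t f \<noteq> 0" "moment t g \<noteq> 0" for t
      using f_nz g_nz by (auto simp: moment_eq_0_iff)
    show ?thesis
    proof (cases "moment r f = \<infinity> \<or> moment s g = \<infinity>")
      case True
      \<comment> \<open>In \<open>[0, \<infinity>]\<close> the product \<open>\<infinity> * 0\<close> is \<open>0\<close>, so the other moment has to be nonzero.\<close>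
      then have "moment r f epowr \<theta> r * moment s g epowr \<theta> s = \<infinity>"
        using m_nz by (auto simp: top_epowr ennreal_mult_eq_top_iff epowr_eq_0_iff)
      moreover have "moment r f * moment r g = \<infinity>" if "s = r"
        using True m_nz that by (auto simp: ennreal_mult_eq_top_iff)
      ultimately show ?thesis by simp
    next
      case False
      then obtain m m' where m: "moment r f = ennreal m" "0 \<le> m" and m': "moment s g = ennreal m'" "0 \<le> m'"
        by (metis ennreal_cases infinity_ennreal_def)
      have "C r * L * N powr (2 * \<theta> r) \<le> m powr \<theta> r * N"
        using moment_lower_bound[OF r q f1 N(1,2) m] L by (simp add: L_def C_def \<theta>_def a_def)
      moreover have "C s * L' * N' powr (2 * \<theta> s) \<le> m' powr \<theta> s * N'"
        using moment_lower_bound[OF s q g1 N'(1,2) m'] L' by (simp add: L'_def C_def \<theta>_def a_def)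
      ultimately have main: "C r * C s * k powr a * N powr (2 * \<theta> r) * N' powr (2 * \<theta> s)
          \<le> m powr \<theta> r * m' powr \<theta> s"
        using k L L' N N' C[OF r] C[OF s] by (intro combine_moment_bounds) (auto intro: less_imp_le)
      have "ennreal (C r * C s * k powr a) * Lp_norm q f epowr (2 * \<theta> r) * Lp_norm q g epowr (2 * \<theta> s)
          \<le> moment r f epowr \<theta> r * moment s g epowr \<theta> s"
        using main C[OF r] C[OF s] N N' m m'
        by (simp add: epowr_ennreal ennreal_mult'[symmetric] ennreal_leI)
      moreover have "ennreal (C r powr (2 / \<theta> r) * k powr (r - 1 + 2 * a)) * (Lp_norm q f)\<^sup>2 * (Lp_norm q g)\<^sup>2
          \<le> moment r f * moment r g" if sr: "s = r"
      proof -
        \<comment> \<open>Raising the first inequality to the power \<open>1 / \<theta> r\<close> gives the second one.\<close>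
        define e where "e = 1 / \<theta> r"
        have e: "0 < e" "\<theta> r * e = 1" "a * e = r - 1 + 2 * a"
          using \<theta>[OF r] a r by (auto simp: e_def \<theta>_def)
        have "(C r * C r * k powr a * N powr (2 * \<theta> r) * N' powr (2 * \<theta> r)) powr e
            \<le> (m powr \<theta> r * m' powr \<theta> r) powr e"
          using main e C[OF r] unfolding sr by (intro powr_mono2) auto
        also have "\<dots> = m * m'"
          using m m' e by (simp add: powr_mult powr_powr)
        also have "(C r * C r * k powr a * N powr (2 * \<theta> r) * N' powr (2 * \<theta> r)) powr e
            = C r powr (2 / \<theta> r) * k powr (r - 1 + 2 * a) * N\<^sup>2 * N'\<^sup>2"
        proof -
          have "(x powr (2 * \<theta> r)) powr e = x\<^sup>2" if "0 < x" for x
            using that by (simp add: powr_powr mult.assoc e(2) powr_numeral)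
          moreover have "C r powr (2 / \<theta> r) = C r powr e * C r powr e"
            by (simp add: e_def powr_add[symmetric])
          moreover have "(k powr a) powr e = k powr (r - 1 + 2 * a)"
            by (simp add: powr_powr e(3))
          ultimately show ?thesis using C[OF r] k N N'
            by (simp add: powr_mult del: powr_powr)
        qed
        finally show ?thesis
          using m m' N N' unfolding sr
          by (simp add: ennreal_mult'[symmetric] ennreal_power ennreal_leI)
      qed
      ultimately show ?thesis by blast
    qed
  qed
  note result = this
  note exps = exponent_moment[OF q r] exponent_moment[OF q s] exponent_norm[OF q r] exponent_norm[OF q s]
    exponent_k[OF q] exponent_const[OF q r] exponent_k_symmetric[OF q r]
  show "ennreal (moment_const r (conj_recip q) * moment_const s (conj_recip q) * k powr exponent_at q (\<lambda>q. 1 - 1 / q)) *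
            Lp_norm q f epowr exponent_at q (\<lambda>q. (2 * q - 2) / (q * r + q - 2)) *
            Lp_norm q (A f) epowr exponent_at q (\<lambda>q. (2 * q - 2) / (q * s + q - 2))
      \<le> moment r f epowr exponent_at q (\<lambda>q. (q - 1) / (q * r + q - 2)) *
        moment s (A f) epowr exponent_at q (\<lambda>q. (q - 1) / (q * s + q - 2))"
    unfolding exps by (rule result[THEN conjunct1, unfolded C_def \<theta>_def a_def g_def])
  show "ennreal (moment_const r (conj_recip q) powr exponent_at q (\<lambda>q. 2 * (q * r + q - 2) / (q - 1)) *
                        k powr exponent_at q (\<lambda>q. (q * r + q - 2) / q)) *
              (Lp_norm q f)\<^sup>2 * (Lp_norm q (A f))\<^sup>2 \<le> moment r f * moment r (A f)" if "s = r"
    unfolding exps by (rule result[THEN conjunct2, rule_format, OF that, unfolded C_def \<theta>_def a_def g_def])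
qed

end
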